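(* Let $p$ be an odd prime, let $W=\mathbb F_p^4$, and set $V=\bigwedge^2W$ with the wedge-pairing quadratic form. Let $\omega\in\bigwedge^3V^*$ correspond to $$(Q,Q^\vee)\in\operatorname{Sym}^2(W^* )\oplus\operatorname{Sym}^2(W),$$ where $Q=Q_\omega$ is a quadratic form on $W$ and $Q^\vee=Q_\omega^\vee$ is a quadratic form on $W^*$. Then $\omega$ has no dual null Lagrangian pair if and only if there is a $2$-plane $R\subset W$ such that $$\operatorname{rad}(Q)=R,$$ the induced binary quadratic form on $W/R$ is anisotropic, $$\operatorname{rad}(Q^\vee)=R^\perp\subset W^*,$$ and the induced binary quadratic form on $W^*/R^\perp$ is anisotropic. Equivalently, there is a $2$-plane $R\subset W$ such that $$Z(Q)=\mathbb P(R)\subset\mathbb P(W),\qquad Z(Q^\vee)=\mathbb P(R^\perp)\subset\mathbb P(W^* ).$$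
   Context: Let $w_1,\dots,w_4$ be the standard basis of $W$ and $\operatorname{vol}=w_1\wedge w_2\wedge w_3\wedge w_4$. The wedge-pairing form on $V$ is the symmetric bilinear form with $\langle\alpha,\beta\rangle\operatorname{vol}=\alpha\wedge\beta$; it is a split $6$-dimensional quadratic space. A Lagrangian is a totally isotropic $3$-dimensional subspace of $V$. It is null for $\omega$ if $\omega$ restricts to zero on it. A dual null Lagrangian pair for $\omega$ is a pair of Lagrangians $L_1,L_2$, both null for $\omega$, with $V=L_1\oplus L_2$. Use the basis $u_1=w_1\wedge w_2$, $u_2=w_1\wedge w_3$, $u_3=w_1\wedge w_4$, $u_4=w_2\wedge w_3$, $u_5=w_2\wedge w_4$, $u_6=w_3\wedge w_4$ of $V$ and write $\omega=\sum_{i<j<k}c_{ijk}\,u_i^*\wedge u_j^*\wedge u_k^*$. The correspondence $\omega\leftrightarrow(Q_\omega,Q_\omega^\vee)$ is the linear isomorphism $\bigwedge^3(\bigwedge^2W)^*\cong\operatorname{Sym}^2(W^* )\oplus\operatorname{Sym}^2(W)$ given, for $x=(x_1,\dots,x_4)\in W$ and $\varphi=(\varphi_1,\dots,\varphi_4)\in W^*$ (dual coordinates), by $$\begin{aligned}Q_\omega(x)={}&c_{123}x_1^2+(c_{125}-c_{134})x_1x_2+(c_{126}-c_{234})x_1x_3+(c_{136}-c_{235})x_1x_4+c_{145}x_2^2\\&+(c_{146}+c_{245})x_2x_3+(c_{156}+c_{345})x_2x_4+c_{246}x_3^2+(c_{256}+c_{346})x_3x_4+c_{356}x_4^2,\end{aligned}$$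 $$\begin{aligned}Q_\omega^\vee(\varphi)={}&c_{456}\varphi_1^2+(-c_{256}+c_{346})\varphi_1\varphi_2+(c_{156}-c_{345})\varphi_1\varphi_3+(-c_{146}+c_{245})\varphi_1\varphi_4+c_{236}\varphi_2^2\\&+(-c_{136}-c_{235})\varphi_2\varphi_3+(c_{126}+c_{234})\varphi_2\varphi_4+c_{135}\varphi_3^2+(-c_{125}-c_{134})\varphi_3\varphi_4+c_{124}\varphi_4^2.\end{aligned}$$ (These satisfy: $\omega$ vanishes on $x\wedge W$ iff $Q_\omega(x)=0$, for $0\ne x\in W$; and $\omega$ vanishes on $\bigwedge^2(\ker\varphi)$ iff $Q_\omega^\vee(\varphi)=0$, for $0\neq\varphi\in W^*$.) Since $p$ is odd, elements of $\operatorname{Sym}^2(W^* )$ and $\operatorname{Sym}^2(W)$ are identified with quadratic forms on $W$ and $W^*$. For a quadratic form $q$ on $E$, $B_q(u,v)=q(u+v)-q(u)-q(v)$, $\operatorname{rad}(q)=\{u\in E:B_q(u,v)=0\ \forall v\in E\}$, and $q$ descends to a nondegenerate form on $E/\operatorname{rad}(q)$. A binary quadratic form (on a $2$-dimensional space) is anisotropic if it has no nonzero zero. $\mathbb P(E)$ is the set of one-dimensional subspaces of $E$ and $Z(q)=\{[v]\in\mathbb P(E):q(v)=0\}$. $R^\perp\subset W^*$ is the annihilator of $R$. *)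

theory Defs
  imports "HOL-Analysis.Determinants" "Berlekamp_Zassenhaus.Finite_Field"
begin

text \<open>
  Throughout, \<open>'a^4\<close> is \<open>W\<close> in its standard basis, or \<open>W\<^sup>*\<close> in the dual basis, and
  \<open>'a^6\<close> is the exterior square \<open>V\<close> of \<open>W\<close> in the basis \<open>u\<^sub>1, \<dots>, u\<^sub>6\<close>, where \<open>u\<^sub>k\<close> is
  the wedge product of \<open>w\<^sub>i\<close> and \<open>w\<^sub>j\<close> for \<open>(i, j) = wedge_index k\<close>.
\<close>

definition wedge_index :: "6 \<Rightarrow> 4 \<times> 4" where
  "wedge_index k =
     (if k = 1 then (1, 2) else if k = 2 then (1, 3) else if k = 3 then (1, 4)
      else if k = 4 then (2, 3) else if k = 5 then (2, 4) else (3, 4))"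

definition wedge :: "'a::comm_ring_1^4 \<Rightarrow> 'a^4 \<Rightarrow> 'a^6" where
  "wedge x y = (\<chi> k. case wedge_index k of (i, j) \<Rightarrow> x $ i * y $ j - x $ j * y $ i)"

text \<open>
  The signs below come from reordering \<open>u\<^sub>k \<and> u\<^sub>l\<close> into \<open>w\<^sub>1 \<and> w\<^sub>2 \<and> w\<^sub>3 \<and> w\<^sub>4\<close>;
  see \<open>wedge_pairing_wedge\<close>.
\<close>

definition wedge_pairing :: "'a::comm_ring_1^6 \<Rightarrow> 'a^6 \<Rightarrow> 'a" where
  "wedge_pairing \<alpha> \<beta> =
     \<alpha> $ 1 * \<beta> $ 6 - \<alpha> $ 2 * \<beta> $ 5 + \<alpha> $ 3 * \<beta> $ 4
   + \<alpha> $ 4 * \<beta> $ 3 - \<alpha> $ 5 * \<beta> $ 2 + \<alpha> $ 6 * \<beta> $ 1"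

lemma det_4:
  "det (A :: 'a::comm_ring_1^4^4) =
     (A$1$1 * A$2$2 - A$1$2 * A$2$1) * (A$3$3 * A$4$4 - A$3$4 * A$4$3)
   - (A$1$1 * A$2$3 - A$1$3 * A$2$1) * (A$3$2 * A$4$4 - A$3$4 * A$4$2)
   + (A$1$1 * A$2$4 - A$1$4 * A$2$1) * (A$3$2 * A$4$3 - A$3$3 * A$4$2)
   + (A$1$2 * A$2$3 - A$1$3 * A$2$2) * (A$3$1 * A$4$4 - A$3$4 * A$4$1)
   - (A$1$2 * A$2$4 - A$1$4 * A$2$2) * (A$3$1 * A$4$3 - A$3$3 * A$4$1)
   + (A$1$3 * A$2$4 - A$1$4 * A$2$3) * (A$3$1 * A$4$2 - A$3$2 * A$4$1)"
proof -
  have f: "finite {2::4, 3, 4}" "1 \<notin> {2::4, 3, 4}" "finite {3::4, 4}" "2 \<notin> {3::4, 4}"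
    "finite {4::4}" "3 \<notin> {4::4}"
    by auto
  show ?thesis
    unfolding det_def UNIV_4
    unfolding sum_over_permutations_insert[OF f(1,2)]
    unfolding sum_over_permutations_insert[OF f(3,4)]
    unfolding sum_over_permutations_insert[OF f(5,6)]
    unfolding permutes_sing
    by (simp add: sign_swap_id permutation_swap_id permutation_compose sign_compose
        Transposition.transpose_def) (simp only: algebra_simps)
qed

lemma vector_4:
  "(vector [x, y, z, w] :: 'a::zero^4)$1 = x"
  "(vector [x, y, z, w] :: 'a::zero^4)$2 = y"
  "(vector [x, y, z, w] :: 'a::zero^4)$3 = z"
  "(vector [x, y, z, w] :: 'a::zero^4)$4 = w"
  unfolding vector_def by simp_all

lemma wedge_pairing_wedge:
  "wedge_pairing (wedge x y) (wedge z w) = det (vector [x, y, z, w] :: 'a::comm_ring_1^4^4)"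
  by (simp add: wedge_pairing_def wedge_def wedge_index_def det_4 vector_4)

text \<open>
  Elements of the third exterior power of \<open>V\<^sup>*\<close> are alternating trilinear forms on \<open>V\<close>; the basis
  element \<open>u\<^sub>i\<^sup>* \<and> u\<^sub>j\<^sup>* \<and> u\<^sub>k\<^sup>*\<close> is the \<open>3 \<times> 3\<close> minor in the coordinates \<open>i, j, k\<close>, so that
  \<open>c\<^sub>i\<^sub>j\<^sub>k\<close> is the value at \<open>(u\<^sub>i, u\<^sub>j, u\<^sub>k)\<close>.
\<close>

definition alternating_trilinear :: "('a::field^'n \<Rightarrow> 'a^'n \<Rightarrow> 'a^'n \<Rightarrow> 'a) \<Rightarrow> bool" where
  "alternating_trilinear \<omega> \<longleftrightarrow>
     (\<forall>y z. Vector_Spaces.linear (*s) (*) (\<lambda>x. \<omega> x y z)) \<and>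
     (\<forall>x z. Vector_Spaces.linear (*s) (*) (\<lambda>y. \<omega> x y z)) \<and>
     (\<forall>x y. Vector_Spaces.linear (*s) (*) (\<lambda>z. \<omega> x y z)) \<and>
     (\<forall>x y. \<omega> x x y = 0 \<and> \<omega> x y y = 0 \<and> \<omega> x y x = 0)"

definition form_coeff :: "('a::field^6 \<Rightarrow> 'a^6 \<Rightarrow> 'a^6 \<Rightarrow> 'a) \<Rightarrow> 6 \<Rightarrow> 6 \<Rightarrow> 6 \<Rightarrow> 'a" where
  "form_coeff \<omega> i j k = \<omega> (axis i 1) (axis j 1) (axis k 1)"

definition Q_form :: "('a::field^6 \<Rightarrow> 'a^6 \<Rightarrow> 'a^6 \<Rightarrow> 'a) \<Rightarrow> 'a^4 \<Rightarrow> 'a" where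
  "Q_form \<omega> x = (let c = form_coeff \<omega> in
       c 1 2 3 * (x$1)^2
     + (c 1 2 5 - c 1 3 4) * x$1 * x$2
     + (c 1 2 6 - c 2 3 4) * x$1 * x$3
     + (c 1 3 6 - c 2 3 5) * x$1 * x$4
     + c 1 4 5 * (x$2)^2
     + (c 1 4 6 + c 2 4 5) * x$2 * x$3
     + (c 1 5 6 + c 3 4 5) * x$2 * x$4
     + c 2 4 6 * (x$3)^2
     + (c 2 5 6 + c 3 4 6) * x$3 * x$4
     + c 3 5 6 * (x$4)^2)"

definition Q_dual_form :: "('a::field^6 \<Rightarrow> 'a^6 \<Rightarrow> 'a^6 \<Rightarrow> 'a) \<Rightarrow> 'a^4 \<Rightarrow> 'a" where
  "Q_dual_form \<omega> \<phi> = (let c = form_coeff \<omega> in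
       c 4 5 6 * (\<phi>$1)^2
     + (- c 2 5 6 + c 3 4 6) * \<phi>$1 * \<phi>$2
     + (c 1 5 6 - c 3 4 5) * \<phi>$1 * \<phi>$3
     + (- c 1 4 6 + c 2 4 5) * \<phi>$1 * \<phi>$4
     + c 2 3 6 * (\<phi>$2)^2
     + (- c 1 3 6 - c 2 3 5) * \<phi>$2 * \<phi>$3
     + (c 1 2 6 + c 2 3 4) * \<phi>$2 * \<phi>$4
     + c 1 3 5 * (\<phi>$3)^2
     + (- c 1 2 5 - c 1 3 4) * \<phi>$3 * \<phi>$4
     + c 1 2 4 * (\<phi>$4)^2)"

definition lagrangian :: "('a::field^6) set \<Rightarrow> bool" where
  "lagrangian L \<longleftrightarrow> vec.subspace L \<and> vec.dim L = 3 \<and> (\<forall>\<alpha>\<in>L. \<forall>\<beta>\<in>L. wedge_pairing \<alpha> \<beta> = 0)"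

definition null_for :: "('a::field^6 \<Rightarrow> 'a^6 \<Rightarrow> 'a^6 \<Rightarrow> 'a) \<Rightarrow> ('a^6) set \<Rightarrow> bool" where
  "null_for \<omega> L \<longleftrightarrow> (\<forall>x\<in>L. \<forall>y\<in>L. \<forall>z\<in>L. \<omega> x y z = 0)"

definition dual_null_lagrangian_pair ::
    "('a::field^6 \<Rightarrow> 'a^6 \<Rightarrow> 'a^6 \<Rightarrow> 'a) \<Rightarrow> ('a^6) set \<Rightarrow> ('a^6) set \<Rightarrow> bool" where
  "dual_null_lagrangian_pair \<omega> L\<^sub>1 L\<^sub>2 \<longleftrightarrow>
     lagrangian L\<^sub>1 \<and> lagrangian L\<^sub>2 \<and> null_for \<omega> L\<^sub>1 \<and> null_for \<omega> L\<^sub>2 \<and>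
     L\<^sub>1 \<inter> L\<^sub>2 = {0} \<and> {x + y | x y. x \<in> L\<^sub>1 \<and> y \<in> L\<^sub>2} = UNIV"

definition polar_form :: "('a::field^'n \<Rightarrow> 'a) \<Rightarrow> 'a^'n \<Rightarrow> 'a^'n \<Rightarrow> 'a" where
  "polar_form q u v = q (u + v) - q u - q v"

definition radical :: "('a::field^'n \<Rightarrow> 'a) \<Rightarrow> ('a^'n) set" where
  "radical q = {u. \<forall>v. polar_form q u v = 0}"

definition quotient_space :: "('a::field^'n) set \<Rightarrow> ('a^'n) set set" where
  "quotient_space R = UNIV // {(x, y). x - y \<in> R}"

text \<open>
  The value of \<open>q\<close> on a coset, meaningful when \<open>q\<close> is constant on it; for \<open>R = radical q\<close> this
  is \<open>induced_form_radical\<close>.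
\<close>

definition induced_form :: "('a::field^'n \<Rightarrow> 'a) \<Rightarrow> ('a^'n) set \<Rightarrow> 'a" where
  "induced_form q X = the_elem (q ` X)"

text \<open>The zero vector of the quotient by \<open>R\<close> is the coset \<open>R\<close> itself.\<close>

definition anisotropic_quotient :: "('a::field^'n \<Rightarrow> 'a) \<Rightarrow> ('a^'n) set \<Rightarrow> bool" where
  "anisotropic_quotient q R \<longleftrightarrow> (\<forall>X\<in>quotient_space R. X \<noteq> R \<longrightarrow> induced_form q X \<noteq> 0)"

lemma induced_form_radical:
  fixes q :: "'a::field^'n \<Rightarrow> 'a"
  assumes hom: "\<And>c v. q (c *s v) = c\<^sup>2 * q v" and two: "(2::'a) \<noteq> 0"
  shows "induced_form q ({(x, y). x - y \<in> radical q} `` {v}) = q v"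
proof -
  have rad0: "q u = 0" if "u \<in> radical q" for u
  proof -
    have "2 *s u = u + u"
      by (simp add: vec_eq_iff)
    moreover have "polar_form q u u = 0"
      using that by (simp add: radical_def)
    ultimately have "q (2 *s u) - q u - q u = 0"
      by (simp add: polar_form_def)
    hence "2 * q u = 0"
      unfolding hom by (simp add: power2_eq_square)
    thus ?thesis using two by simp
  qed
  have eq: "q y = q v" if "v - y \<in> radical q" for y
  proof -
    have "polar_form q (v - y) y = 0" using that by (simp add: radical_def)
    with rad0[OF that] show ?thesis by (simp add: polar_form_def)
  qed
  have "q 0 = 0" using hom[of 0 0] by simp
  hence "0 \<in> radical q" by (simp add: radical_def polar_form_def)
  hence "v \<in> {(x, y). x - y \<in> radical q} `` {v}" by simp
  moreover have "q y = q v" if "y \<in> {(x, y). x - y \<in> radical q} `` {v}" for y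
    using that eq by simp
  ultimately have "q ` ({(x, y). x - y \<in> radical q} `` {v}) = {q v}"
    by blast
  thus ?thesis by (simp add: induced_form_def)
qed

definition annihilator :: "('a::field^'n) set \<Rightarrow> ('a^'n) set" where
  "annihilator R = {\<phi>. \<forall>x\<in>R. (\<Sum>i\<in>UNIV. \<phi> $ i * x $ i) = 0}"

definition proj :: "('a::field^'n) set \<Rightarrow> ('a^'n) set set" where
  "proj E = {l. vec.subspace l \<and> vec.dim l = 1 \<and> l \<subseteq> E}"

definition zero_locus :: "('a::field^'n \<Rightarrow> 'a) \<Rightarrow> ('a^'n) set set" where
  "zero_locus q = {vec.span {v} | v. v \<noteq> 0 \<and> q v = 0}"

end

theory Submission
  imports Defs
begin

text \<open>
  A Lagrangian is either \<open>x \<and> W\<close> for some \<open>x \<in> W\<close> or the exterior square of \<open>ker \<phi>\<close> for some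
  \<open>\<phi> \<in> W\<^sup>*\<close>. Two of the same kind always meet, and two of different kinds are complementary iff
  \<open>\<phi>(x) \<noteq> 0\<close>. So a dual null pair is a zero \<open>x\<close> of \<open>Q\<close> together with a zero \<open>\<phi>\<close> of \<open>Q\<^sup>\<or>\<close>
  such that \<open>\<phi>(x) \<noteq> 0\<close>, and there is none iff the spans of the two zero sets annihilate each other.
  Every hyperplane contains a nonzero zero of a quaternary form over a finite field, hence
  the zeros span at least a plane, and if they span a plane, they fill it. So mutually annihilating
  zero sets are \<open>R\<close> and \<open>R\<^sup>\<bottom>\<close> for a plane \<open>R\<close>.
\<close>

subsection \<open>Quadratic forms over finite fields\<close>

definition dot :: "'a::comm_ring_1^'n \<Rightarrow> 'a^'n \<Rightarrow> 'a" where
  "dot \<phi> x = (\<Sum>i\<in>UNIV. \<phi> $ i * x $ i)"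

text \<open>Linearity of the polar form is asked for in the first slot; symmetry carries it to the
  second.\<close>

definition quadratic_form :: "('a::field^'n \<Rightarrow> 'a) \<Rightarrow> bool" where
  "quadratic_form q \<longleftrightarrow> (\<forall>c v. q (c *s v) = c\<^sup>2 * q v) \<and>
     (\<forall>u v w. polar_form q (u + v) w = polar_form q u w + polar_form q v w) \<and>
     (\<forall>c u w. polar_form q (c *s u) w = c * polar_form q u w)"

lemma polar_form_commute: "polar_form q u v = polar_form q v u"
  by (simp add: polar_form_def add.commute)

lemma quadratic_form_add: "q (u + v) = q u + q v + polar_form q u v"
  by (simp add: polar_form_def)

lemma
  assumes "quadratic_form q"
  shows quadratic_form_scale: "q (c *s v) = c\<^sup>2 * q v"
    and polar_form_add_left: "polar_form q (u + v) w = polar_form q u w + polar_form q v w"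
    and polar_form_scale_left: "polar_form q (c *s u) w = c * polar_form q u w"
    and polar_form_add_right: "polar_form q w (u + v) = polar_form q w u + polar_form q w v"
    and polar_form_scale_right: "polar_form q w (c *s u) = c * polar_form q w u"
  using assms by (auto simp: quadratic_form_def polar_form_commute[of q w])

lemmas quadratic_form_simps = quadratic_form_scale polar_form_add_left
  polar_form_scale_left polar_form_add_right polar_form_scale_right

lemma polar_form_self: "quadratic_form q \<Longrightarrow> polar_form q u u = 2 * q u"
  using quadratic_form_scale[of q 2 u]
  by (simp add: polar_form_def vec.scale_left_distrib[of 1 1, simplified] power2_eq_square)

lemma quadratic_form_zero: "quadratic_form q \<Longrightarrow> q 0 = 0"
  using quadratic_form_scale[of q 0 0] by simp

lemma quadratic_form_monomial: "quadratic_form (\<lambda>x. c * x$i * x$j)"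
  by (simp add: quadratic_form_def polar_form_def power2_eq_square algebra_simps)

lemma quadratic_form_plus:
  assumes "quadratic_form q" "quadratic_form r"
  shows "quadratic_form (\<lambda>x. q x + r x)"
proof -
  have "polar_form (\<lambda>x. q x + r x) u v = polar_form q u v + polar_form r u v" for u v
    by (simp add: polar_form_def)
  with assms show ?thesis
    by (simp add: quadratic_form_def distrib_left add_ac)
qed

lemma quadratic_form_Q_form: "quadratic_form (Q_form \<omega>)"
  \<comment> \<open>Left-associated products give every summand, squares included, the shape of
    \<open>quadratic_form_monomial\<close>.\<close>
  unfolding Q_form_def[abs_def] Let_def power2_eq_square mult.assoc[symmetric]
  by (intro quadratic_form_plus quadratic_form_monomial)

text \<open>The induced form takes on a coset the value at any representative, and the coset of
  \<open>v\<close> is the zero coset exactly when \<open>v\<close> lies in \<open>R\<close>. So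
  anisotropy can be tested on vectors.\<close>

lemma anisotropic_quotient_radical:
  fixes q :: "'a::field^'n \<Rightarrow> 'a"
  assumes q: "quadratic_form q" and two: "(2::'a) \<noteq> 0" and R: "vec.subspace R" and rad: "radical q = R"
  shows "anisotropic_quotient q R \<longleftrightarrow> (\<forall>v. v \<notin> R \<longrightarrow> q v \<noteq> 0)"
proof -
  let ?coset = "\<lambda>v. {(x, y). x - y \<in> R} `` {v}"
  have "induced_form q (?coset v) = q v" for v
    using induced_form_radical[of q v] quadratic_form_scale[OF q] two rad by simp
  moreover have "?coset v = R \<longleftrightarrow> v \<in> R" for v
  proof
    assume "?coset v = R"
    then have "0 \<in> ?coset v" using vec.subspace_0[OF R] by (simp only:)
    then show "v \<in> R" by simp
  next
    assume v: "v \<in> R"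
    have "v - y \<in> R \<longleftrightarrow> y \<in> R" for y
      using vec.subspace_diff[OF R v, of y] vec.subspace_diff[OF R v, of "v - y"]
      by (metis diff_diff_eq2 add_diff_cancel_left')
    then show "?coset v = R" by (simp add: set_eq_iff)
  qed
  ultimately show ?thesis
    by (auto simp: anisotropic_quotient_def quotient_space_def quotient_def)
qed

text \<open>A radical vector is a zero because \<open>polar_form q u u = 2 * q u\<close>, and
  anisotropy excludes all other zeros. Conversely, if the zeros form a subspace, a zero
  \<open>u\<close> not orthogonal to \<open>v\<close> would put a zero on the line through
  \<open>v\<close> in direction \<open>u\<close>; this forces \<open>v\<close> and
  \<open>u + v\<close> to be zeros as well, contradicting non-orthogonality.\<close>

lemma zeros_eq_iff_radical:
  fixes q :: "'a::field^'n \<Rightarrow> 'a"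
  assumes q: "quadratic_form q" and two: "(2::'a) \<noteq> 0" and R: "vec.subspace R"
  shows "{v. q v = 0} = R \<longleftrightarrow> radical q = R \<and> anisotropic_quotient q R"
proof -
  have rad: "q u = 0" if "u \<in> radical q" for u
    using that polar_form_self[OF q, of u] two by (simp add: radical_def)
  have "radical q = R" if zeros: "{v. q v = 0} = R"
  proof
    show "radical q \<subseteq> R" using rad zeros by auto
    show "R \<subseteq> radical q"
    proof
      fix u assume u: "u \<in> R"
      have "polar_form q u v = 0" for v
      proof (rule ccontr)
        assume B: "polar_form q u v \<noteq> 0"
        \<comment> \<open>As \<open>q u = 0\<close>, the value of \<open>q\<close> at
          \<open>t *s u + v\<close> is affine in \<open>t\<close>; this is its root.\<close>
        define t where "t = - q v / polar_form q u v"
        have "q u = 0" using u zeros by auto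
        then have "q (t *s u + v) = q v + t * polar_form q u v"
          by (simp add: quadratic_form_simps[OF q] quadratic_form_add[of q] \<open>q u = 0\<close>)
        also have "\<dots> = 0" using B by (simp add: t_def)
        finally have "q (t *s u + v) = 0" .
        then have "t *s u + v \<in> R" using zeros by auto
        then have "v \<in> R"
          using vec.subspace_diff[OF R _ vec.subspace_scale[OF R u, of t]] by fastforce
        then have "q v = 0" "q (u + v) = 0" using zeros vec.subspace_add[OF R u] by auto
        with B \<open>q u = 0\<close> show False by (simp add: polar_form_def)
      qed
      then show "u \<in> radical q" by (simp add: radical_def)
    qed
  qed
  then show ?thesis
    using anisotropic_quotient_radical[OF q two R] rad by auto
qed

section \<open>Projective zero loci\<close>

lemma proj_eq:
  assumes "vec.subspace R"
  shows "proj R = {vec.span {v} | v. v \<noteq> 0 \<and> v \<in> R}"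
proof (intro equalityI subsetI)
  fix l assume "l \<in> proj R"
  then have l: "vec.subspace l" "vec.dim l = 1" "l \<subseteq> R" by (auto simp: proj_def)
  from vec.basis_exists[of l] obtain B where B: "B \<subseteq> l" "vec.independent B" "l \<subseteq> vec.span B" "card B = 1"
    using l(2) by metis
  then obtain v where v: "B = {v}" by (auto simp: card_1_singleton_iff)
  then have "l = vec.span {v}" using B l(1) vec.span_minimal[of B l] by auto
  moreover have "v \<noteq> 0" "v \<in> R" using B v l by auto
  ultimately show "l \<in> {vec.span {v} | v. v \<noteq> 0 \<and> v \<in> R}" by auto
next
  fix l assume "l \<in> {vec.span {v} | v. v \<noteq> 0 \<and> v \<in> R}"
  then obtain v where "l = vec.span {v}" "v \<noteq> 0" "v \<in> R" by auto
  then show "l \<in> proj R"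
    using vec.span_minimal[of "{v}" R] assms by (auto simp: proj_def)
qed

text \<open>By homogeneity, vanishing on a line does not depend on the spanning vector. The zero
  vector spans no projective point, but it lies both in the zero set and in
  \<open>R\<close>.\<close>

lemma zero_locus_eq_proj_iff:
  fixes q :: "'a::field^'n \<Rightarrow> 'a"
  assumes q: "quadratic_form q" and R: "vec.subspace R"
  shows "zero_locus q = proj R \<longleftrightarrow> {v. q v = 0} = R"
proof
  assume eq: "zero_locus q = proj R"
  have zero: "q 0 = 0" "0 \<in> R"
    using quadratic_form_zero[OF q] vec.subspace_0[OF R] by auto
  have "v \<in> R" if "q v = 0" "v \<noteq> 0" for v
  proof -
    have "vec.span {v} \<in> proj R" using that eq by (auto simp: zero_locus_def)
    then show ?thesis by (auto simp: proj_def intro: vec.span_base)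
  qed
  moreover have "q v = 0" if "v \<in> R" "v \<noteq> 0" for v
  proof -
    have "vec.span {v} \<in> zero_locus q" using that eq proj_eq[OF R] by auto
    then obtain w where w: "vec.span {v} = vec.span {w}" "q w = 0"
      by (auto simp: zero_locus_def)
    have "v \<in> vec.span {w}" using w(1) vec.span_base[of v "{v}"] by auto
    then obtain c where "v = c *s w" by (auto simp: vec.span_singleton)
    then show ?thesis using w(2) quadratic_form_scale[OF q] by simp
  qed
  ultimately show "{v. q v = 0} = R" using zero by auto
next
  assume "{v. q v = 0} = R"
  then show "zero_locus q = proj R" by (auto simp: zero_locus_def proj_eq[OF R])
qed

section \<open>Isotropic vectors by counting squares\<close>

lemma card_squares:
  assumes "odd CARD('a::{field,finite})"
  shows "CARD('a) < 2 * card (range (\<lambda>x::'a. x\<^sup>2))"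
proof -
  \<comment> \<open>Squaring has fibres of size at most two, which gives the weak inequality; parity
    of the field size makes it strict.\<close>
  have "card {x::'a. x\<^sup>2 = y} \<le> 2" if "y \<in> range (\<lambda>x::'a. x\<^sup>2)" for y
  proof -
    from that obtain z where "y = z\<^sup>2" by auto
    then have "{x::'a. x\<^sup>2 = y} \<subseteq> {z, - z}" by (auto simp: power2_eq_iff)
    then have "card {x::'a. x\<^sup>2 = y} \<le> card {z, - z}" by (intro card_mono) auto
    also have "\<dots> \<le> 2" by (simp add: card_insert_if)
    finally show ?thesis .
  qed
  then have "(\<Sum>y\<in>range (\<lambda>x::'a. x\<^sup>2). card {x::'a. x\<^sup>2 = y}) \<le> card (range (\<lambda>x::'a. x\<^sup>2)) * 2"
    using sum_bounded_above[of "range (\<lambda>x::'a. x\<^sup>2)" "\<lambda>y. card {x::'a. x\<^sup>2 = y}" 2] by simp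
  moreover have "CARD('a) = (\<Sum>y\<in>range (\<lambda>x::'a. x\<^sup>2). card {x::'a. x\<^sup>2 = y})"
    by (subst card_UN_disjoint[symmetric]) (auto intro!: arg_cong[where f = card])
  ultimately have "CARD('a) \<le> 2 * card (range (\<lambda>x::'a. x\<^sup>2))" by simp
  with assms show ?thesis by (cases "CARD('a) = 2 * card (range (\<lambda>x::'a. x\<^sup>2))") auto
qed

text \<open>Pigeonhole: the values \<open>x * a\<close> and \<open>c - x * b\<close>, with
  \<open>x\<close> a square, each fill more than half of the field, so they share an
  element.\<close>

lemma diagonal_binary_form_represents:
  fixes a b c :: "'a::{field,finite}"
  assumes "odd CARD('a)" "a \<noteq> 0" "b \<noteq> 0"
  shows "\<exists>r s. r\<^sup>2 * a + s\<^sup>2 * b = c"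
proof (rule ccontr)
  assume none: "\<nexists>r s. r\<^sup>2 * a + s\<^sup>2 * b = c"
  let ?S = "range (\<lambda>x::'a. x\<^sup>2)"
  have "card ((\<lambda>x. x * a) ` ?S) = card ?S" "card ((\<lambda>x. c - x * b) ` ?S) = card ?S"
    using assms by (auto intro!: card_image simp: inj_on_def)
  moreover have "(\<lambda>x. x * a) ` ?S \<inter> (\<lambda>x. c - x * b) ` ?S = {}"
    using none by (auto simp: algebra_simps)
  ultimately have "2 * card ?S = card ((\<lambda>x. x * a) ` ?S \<union> (\<lambda>x. c - x * b) ` ?S)"
    by (subst card_Un_disjoint) auto
  also have "\<dots> \<le> CARD('a)" by (intro card_mono) auto
  finally show False using card_squares[OF assms(1)] by simp
qed

text \<open>Gram-Schmidt turns \<open>x, y, z\<close> into orthogonal \<open>x, y', z'\<close>.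
  Unless \<open>q x\<close> or \<open>q y'\<close> vanishes, the diagonal form on
  \<open>x, y'\<close> represents \<open>- q z'\<close>. Nontriviality is asserted of the
  coefficients, so the vector itself is known to be nonzero only when \<open>x, y, z\<close> are
  independent.\<close>

lemma ternary_form_isotropic:
  fixes q :: "'a::{field,finite}^'n \<Rightarrow> 'a"
  assumes q: "quadratic_form q" and odd: "odd CARD('a)" and two: "(2::'a) \<noteq> 0"
  shows "\<exists>r s t. (r, s, t) \<noteq> (0, 0, 0) \<and> q (r *s x + s *s y + t *s z) = 0"
proof -
  note simps = quadratic_form_simps[OF q] quadratic_form_add[of q] polar_form_self[OF q]
  \<comment> \<open>The factor 2 in the denominators comes from \<open>polar_form_self\<close>.
    Orthogonality is claimed only in the case where \<open>q x\<close> and \<open>q y'\<close> are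
    nonzero.\<close>
  define k where "k = - polar_form q x y / (2 * q x)"
  define y' where "y' = k *s x + y"
  define l where "l = - polar_form q x z / (2 * q x)"
  define m where "m = - polar_form q y' z / (2 * q y')"
  define z' where "z' = l *s x + m *s y' + z"
  show ?thesis
  proof (cases "q x = 0 \<or> q y' = 0")
    case True
    then have "q (1 *s x + 0 *s y + 0 *s z) = 0 \<or> q (k *s x + 1 *s y + 0 *s z) = 0"
      by (simp add: y'_def)
    then show ?thesis by (metis prod.inject zero_neq_one)
  next
    case False
    have "polar_form q x y' = k * (2 * q x) + polar_form q x y"
      by (simp add: y'_def simps)
    also have "\<dots> = 0" using False two by (simp add: k_def)
    finally have xy: "polar_form q x y' = 0" .
    have "polar_form q x z' = l * (2 * q x) + polar_form q x z"
      using xy by (simp add: z'_def simps)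
    also have "\<dots> = 0" using False two by (simp add: l_def)
    finally have xz: "polar_form q x z' = 0" .
    have "polar_form q y' z' = m * (2 * q y') + polar_form q y' z"
      using xy by (simp add: z'_def simps polar_form_commute[of q y' x])
    also have "\<dots> = 0" using False two by (simp add: m_def)
    finally have yz: "polar_form q y' z' = 0" .
    obtain r s where rs: "r\<^sup>2 * q x + s\<^sup>2 * q y' = - q z'"
      using diagonal_binary_form_represents[OF odd] False by blast
    have "q (r *s x + s *s y' + z') = 0"
      using rs by (simp add: simps xy xz yz)
    moreover have "r *s x + s *s y' + z' = (r + s * k + l + m * k) *s x + (s + m) *s y + 1 *s z"
      by (simp add: y'_def z'_def vec_eq_iff algebra_simps)
    ultimately have "q ((r + s * k + l + m * k) *s x + (s + m) *s y + 1 *s z) = 0" by simp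
    then show ?thesis by (metis prod.inject zero_neq_one)
  qed
qed

text \<open>
  The hyperplane spanned by \<open>a\<close> and two further basis vectors outside \<open>A\<close> contains an isotropic
  vector; as this lies in \<open>A\<close>, it is a multiple of \<open>a\<close>.
\<close>

lemma zeros_in_plane:
  fixes q :: "'a::{field,finite}^4 \<Rightarrow> 'a"
  assumes q: "quadratic_form q" and odd: "odd CARD('a)" and two: "(2::'a) \<noteq> 0"
    and A: "vec.subspace A" "vec.dim A \<le> 2" "{v. q v = 0} \<subseteq> A" and "a \<in> A"
  shows "q a = 0"
proof (cases "a = 0")
  case True then show ?thesis using quadratic_form_zero[OF q] by simp
next
  case False
  obtain B where B: "{a} \<subseteq> B" "B \<subseteq> A" "vec.independent B" "A \<subseteq> vec.span B"
    using vec.maximal_independent_subset_extend[of "{a}" A] False \<open>a \<in> A\<close> by auto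
  obtain C where C: "B \<subseteq> C" "vec.independent C" "UNIV \<subseteq> vec.span C"
    using vec.maximal_independent_subset_extend[of B UNIV] B(3) by auto
  have "card B \<le> 2" "finite B" "finite C"
    using vec.independent_card_le_dim[OF B(2,3)] A(2) B(3) C(2) vec.finiteI_independent by auto
  moreover have "card C = 4"
    using vec.basis_card_eq_dim[of C UNIV] C by (simp add: card_cart_basis)
  ultimately have "2 \<le> card (C - B)" using C(1) by (simp add: card_Diff_subset)
  then obtain T where "T \<subseteq> C - B" "card T = 2" by (metis obtain_subset_with_card_n)
  then obtain c d where cd: "c \<in> C - B" "d \<in> C - B" "c \<noteq> d"
    by (auto simp: card_2_iff)
  obtain r s t where rst: "(r, s, t) \<noteq> (0, 0, 0)" "q (r *s a + s *s c + t *s d) = 0"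
    using ternary_form_isotropic[OF q odd two] by blast
  have "r *s a + s *s c + t *s d \<in> vec.span B" using rst(2) A(3) B(4) by auto
  moreover have "r *s a \<in> vec.span B" using B(1) by (auto intro: vec.span_scale vec.span_base)
  ultimately have cd_B: "s *s c + t *s d \<in> vec.span B"
    using vec.span_diff[of "r *s a + s *s c + t *s d" B "r *s a"] by (simp add: add.assoc)
  \<comment> \<open>Stated for arbitrary vectors and coefficients so that it also applies with
    \<open>c\<close> and \<open>d\<close> exchanged, which gives \<open>t = 0\<close>.\<close>
  have coeff: "s = 0" if "s *s c + t *s d \<in> vec.span B" "c \<in> C - B" "d \<in> C - B" "c \<noteq> d" for s t c d
  proof (rule ccontr)
    assume "s \<noteq> 0"
    have "s *s c + t *s d \<in> vec.span (C - {c})"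
      using that C(1) vec.span_mono[of B "C - {c}"] by blast
    moreover have "t *s d \<in> vec.span (C - {c})"
      using that by (intro vec.span_scale vec.span_base) auto
    ultimately have "s *s c \<in> vec.span (C - {c})"
      using vec.span_diff[of "s *s c + t *s d" "C - {c}" "t *s d"] by simp
    then have "(1 / s) *s (s *s c) \<in> vec.span (C - {c})" by (rule vec.span_scale)
    then have "c \<in> vec.span (C - {c})" using \<open>s \<noteq> 0\<close> by simp
    then show False using C(2) that(2) by (auto simp: vec.dependent_def)
  qed
  have "s = 0" "t = 0"
    using coeff[of s c t d] coeff[of t d s c] cd cd_B by (auto simp: add.commute)
  then have "r \<noteq> 0" "r\<^sup>2 * q a = 0"
    using rst quadratic_form_scale[OF q] by auto
  then show ?thesis by simp
qed

text \<open>If the zeros spanned at most a line, adjoining a vector \<open>a\<close> outside their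
  span would give a space of dimension at most 2 containing all zeros. By
  \<open>zeros_in_plane\<close>, \<open>a\<close> would then be a zero itself.\<close>

lemma two_le_dim_zeros:
  fixes q :: "'a::{field,finite}^4 \<Rightarrow> 'a"
  assumes q: "quadratic_form q" and odd: "odd CARD('a)" and two: "(2::'a) \<noteq> 0"
  shows "2 \<le> vec.dim {v. q v = 0}"
proof (rule ccontr)
  let ?Z = "{v. q v = 0}"
  assume "\<not> ?thesis"
  then have dim: "vec.dim ?Z \<le> 1" by simp
  then have "vec.span ?Z \<noteq> UNIV"
    using vec.dim_span[of ?Z] by (auto simp: card_cart_basis simp del: vec.dim_span)
  then obtain a where a: "a \<notin> vec.span ?Z" by auto
  have "q a = 0"
  proof (rule zeros_in_plane[OF q odd two])
    show "vec.dim (vec.span (insert a ?Z)) \<le> 2"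
      using dim by (simp add: vec.dim_insert)
    show "?Z \<subseteq> vec.span (insert a ?Z)" "a \<in> vec.span (insert a ?Z)"
      by (auto intro: vec.span_base)
  qed auto
  then show False using a vec.span_base[of a ?Z] by auto
qed

section \<open>Annihilators and their dimension\<close>

lemma annihilator_eq: "annihilator R = {\<phi>. \<forall>x\<in>R. dot \<phi> x = 0}"
  by (simp add: annihilator_def dot_def)

lemma subspace_annihilator: "vec.subspace (annihilator R)"
  by (auto simp: vec.subspace_def annihilator_def algebra_simps sum.distrib sum_distrib_left[symmetric])

lemma subspace_dot_zero: "vec.subspace {x. dot \<phi> x = 0}"
  by (auto simp: vec.subspace_def dot_def algebra_simps sum.distrib sum_distrib_left[symmetric])

text \<open>Extend a basis \<open>B\<close> of \<open>A\<close> to a basis \<open>C\<close> of the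
  whole space. A covector killing \<open>A\<close> is determined by its values on
  \<open>C - B\<close>.\<close>

lemma dim_annihilator_le:
  fixes A :: "('a::field^'n) set"
  shows "vec.dim A + vec.dim (annihilator A) \<le> CARD('n)"
proof -
  obtain B where B: "B \<subseteq> A" "vec.independent B" "A \<subseteq> vec.span B" "card B = vec.dim A"
    by (rule vec.basis_exists)
  obtain C where C: "B \<subseteq> C" "vec.independent C" "UNIV \<subseteq> vec.span C"
    using vec.maximal_independent_subset_extend[of B UNIV] B(2) by auto
  have fin: "finite C" using C(2) vec.finiteI_independent by auto
  have card_C: "card C = CARD('n)"
    using vec.basis_card_eq_dim[of C UNIV] C by (simp add: card_cart_basis)
  \<comment> \<open>The values on \<open>C - B\<close> are stored as coefficients of a vector in the
    span of \<open>C - B\<close>; independence of \<open>C\<close> allows them to be read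
    back.\<close>
  define f where "f = (\<lambda>\<phi>. \<Sum>c\<in>C - B. dot \<phi> c *s c)"
  have lin: "Vector_Spaces.linear (*s) (*s) f"
    by (auto simp: Vector_Spaces.linear_iff f_def dot_def algebra_simps sum.distrib vec.scale_sum_right
        sum_distrib_left vec.scale_left_distrib vec.vector_space_axioms)
  have "\<phi> = 0" if \<phi>: "\<phi> \<in> annihilator A" "f \<phi> = 0" for \<phi>
  proof -
    have "dot \<phi> c = 0" if "c \<in> C - B" for c
      using C(2) \<phi>(2) that fin unfolding f_def vec.dependent_explicit by blast
    moreover have "dot \<phi> c = 0" if "c \<in> B" for c
      using \<phi>(1) B(1) that by (auto simp: annihilator_def dot_def)
    ultimately have "dot \<phi> c = 0" if "c \<in> C" for c using that by blast
    then have "vec.span C \<subseteq> {x. dot \<phi> x = 0}"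
      by (intro vec.span_minimal subspace_dot_zero) auto
    then have "dot \<phi> (axis i 1) = 0" for i using C(3) by auto
    then show "\<phi> = 0" by (simp add: vec_eq_iff dot_def axis_def if_distrib cong: if_cong)
  qed
  then have "inj_on f (annihilator A)"
    using vec.linear_inj_on_iff_eq_0[OF lin subspace_annihilator] by auto
  then have "vec.dim (annihilator A) = vec.dim (f ` annihilator A)"
    using vec.dim_image_eq[OF lin, of "annihilator A"] subspace_annihilator[of A]
    by (simp add: vec.span_eq_iff[THEN iffD2])
  also have "\<dots> \<le> card (C - B)"
  proof (rule vec.dim_le_card)
    show "f ` annihilator A \<subseteq> vec.span (C - B)"
      unfolding f_def by (intro image_subsetI vec.span_sum vec.span_scale vec.span_base)
  qed (use fin in simp)
  finally show ?thesis
    using fin C(1) B(4) card_C card_mono[OF fin C(1)] by (simp add: card_Diff_subset finite_subset)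
qed

subsection \<open>Exterior algebra in coordinates\<close>

lemma exhaust_6: fixes x :: 6 shows "x = 1 \<or> x = 2 \<or> x = 3 \<or> x = 4 \<or> x = 5 \<or> x = 6"
proof (induct x)
  case (of_int z)
  \<comment> \<open>The representative 0 is the index written 6.\<close>
  then have "z = 0 \<or> z = 1 \<or> z = 2 \<or> z = 3 \<or> z = 4 \<or> z = 5" by simp arith
  then show ?case by auto
qed

lemma forall_6: "(\<forall>i::6. P i) \<longleftrightarrow> P 1 \<and> P 2 \<and> P 3 \<and> P 4 \<and> P 5 \<and> P 6"
  by (metis exhaust_6)

lemma UNIV_6: "UNIV = {1, 2, 3, 4, 5, 6::6}"
  using exhaust_6 by auto

lemma sum_6: "sum f (UNIV::6 set) = f 1 + f 2 + f 3 + f 4 + f 5 + f 6"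
  unfolding UNIV_6 by (simp add: ac_simps)

text \<open>
  The Hodge star. It identifies \<open>\<And>\<^sup>2W\<^sup>*\<close> with \<open>\<And>\<^sup>2W\<close>, so that \<open>star ` range (wedge \<phi>)\<close> is the
  exterior square of \<open>ker \<phi>\<close>.
\<close>

definition star :: "'a::comm_ring_1^6 \<Rightarrow> 'a^6" where
  "star \<alpha> = (\<chi> k. if k = 1 then \<alpha>$6 else if k = 2 then - \<alpha>$5 else if k = 3 then \<alpha>$4
     else if k = 4 then \<alpha>$3 else if k = 5 then - \<alpha>$2 else \<alpha>$1)"

lemma star_nth [simp]:
  "star \<alpha> $ 1 = \<alpha> $ 6" "star \<alpha> $ 2 = - \<alpha> $ 5" "star \<alpha> $ 3 = \<alpha> $ 4"
  "star \<alpha> $ 4 = \<alpha> $ 3" "star \<alpha> $ 5 = - \<alpha> $ 2" "star \<alpha> $ 6 = \<alpha> $ 1"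
  by (simp_all add: star_def)

lemma star_star [simp]: "star (star \<alpha>) = \<alpha>"
  by (simp add: vec_eq_iff forall_6)

lemma star_add: "star (\<alpha> + \<beta>) = star \<alpha> + star \<beta>"
  and star_scale: "star (c *s \<alpha>) = c *s star \<alpha>"
  and star_zero [simp]: "star 0 = 0"
  by (simp_all add: vec_eq_iff forall_6)

lemma wedge_nth [simp]:
  "wedge x y $ 1 = x$1 * y$2 - x$2 * y$1" "wedge x y $ 2 = x$1 * y$3 - x$3 * y$1"
  "wedge x y $ 3 = x$1 * y$4 - x$4 * y$1" "wedge x y $ 4 = x$2 * y$3 - x$3 * y$2"
  "wedge x y $ 5 = x$2 * y$4 - x$4 * y$2" "wedge x y $ 6 = x$3 * y$4 - x$4 * y$3"
  by (simp_all add: wedge_def wedge_index_def)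

text \<open>
  \<open>wedge_covector \<alpha> x\<close> is \<open>\<alpha> \<and> x\<close>, read as a covector; consequently
  \<open>wedge_covector (star \<alpha>) \<phi>\<close> is the contraction of \<open>\<alpha>\<close> with \<open>\<phi>\<close>, up to sign.
\<close>

definition wedge_covector :: "'a::comm_ring_1^6 \<Rightarrow> 'a^4 \<Rightarrow> 'a^4" where
  "wedge_covector \<alpha> x = (\<chi> k. wedge_pairing \<alpha> (wedge x (axis k 1)))"

lemma wedge_covector_nth [simp]:
  "wedge_covector \<alpha> x $ 1 = - \<alpha>$4 * x$4 + \<alpha>$5 * x$3 - \<alpha>$6 * x$2"
  "wedge_covector \<alpha> x $ 2 = \<alpha>$2 * x$4 - \<alpha>$3 * x$3 + \<alpha>$6 * x$1"
  "wedge_covector \<alpha> x $ 3 = - \<alpha>$1 * x$4 + \<alpha>$3 * x$2 - \<alpha>$5 * x$1"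
  "wedge_covector \<alpha> x $ 4 = \<alpha>$1 * x$3 - \<alpha>$2 * x$2 + \<alpha>$4 * x$1"
  by (simp_all add: wedge_covector_def wedge_pairing_def axis_def)

lemma covector_wedge: "wedge_pairing \<alpha> (wedge x y) = dot (wedge_covector \<alpha> x) y"
  by (simp add: wedge_pairing_def dot_def sum_4 algebra_simps)

text \<open>The maps \<open>wedge_covector \<alpha>\<close> and
  \<open>wedge_covector (star \<alpha>)\<close> exchange W and its dual and make their sum the
  spinor module of the quadratic space V; this is the polarised Clifford relation.\<close>

lemma clifford_relation:
  "wedge_covector (star \<alpha>) (wedge_covector \<beta> x) + wedge_covector (star \<beta>) (wedge_covector \<alpha> x)
    = - wedge_pairing \<alpha> \<beta> *s x"
  by (simp add: vec_eq_iff forall_4 wedge_pairing_def algebra_simps)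

text \<open>The Leibniz rule for contracting the product of \<alpha> and \<open>x\<close> with
  \<phi>. It writes a multiple of \<alpha> as a sum of elements of the two Lagrangians attached to
  \<open>x\<close> and \<phi>.\<close>

lemma cartan_formula:
  "dot \<phi> x *s \<alpha> = wedge x (wedge_covector (star \<alpha>) \<phi>) + star (wedge \<phi> (wedge_covector \<alpha> x))"
  by (simp add: vec_eq_iff forall_6 dot_def sum_4 algebra_simps)

section \<open>Alternating trilinear forms and their two quadratic forms\<close>

lemma cart_basis_expansion: "x = (\<Sum>i\<in>UNIV. x $ i *s axis i (1::'a::comm_ring_1))"
  by (simp add: vec_eq_iff axis_def if_distrib cong: if_cong)

lemma trilinear_expansion:
  fixes \<omega> :: "'a::field^'n \<Rightarrow> 'a^'n \<Rightarrow> 'a^'n \<Rightarrow> 'a"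
  assumes "alternating_trilinear \<omega>"
  shows "\<omega> \<alpha> \<beta> \<gamma> = (\<Sum>i\<in>UNIV. \<Sum>j\<in>UNIV. \<Sum>k\<in>UNIV.
           \<alpha>$i * \<beta>$j * \<gamma>$k * \<omega> (axis i 1) (axis j 1) (axis k 1))"
proof -
  have l1: "Vector_Spaces.linear (*s) (*) (\<lambda>x. \<omega> x y z)" for y z
    using assms by (simp add: alternating_trilinear_def)
  have l2: "Vector_Spaces.linear (*s) (*) (\<lambda>y. \<omega> x y z)" for x z
    using assms by (simp add: alternating_trilinear_def)
  have l3: "Vector_Spaces.linear (*s) (*) (\<lambda>z. \<omega> x y z)" for x y
    using assms by (simp add: alternating_trilinear_def)
  note sums = module_hom.sum[OF l1[unfolded linear_iff_module_hom]]
    module_hom.sum[OF l2[unfolded linear_iff_module_hom]]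
    module_hom.sum[OF l3[unfolded linear_iff_module_hom]]
  note scales = module_hom.scale[OF l1[unfolded linear_iff_module_hom]]
    module_hom.scale[OF l2[unfolded linear_iff_module_hom]]
    module_hom.scale[OF l3[unfolded linear_iff_module_hom]]
  have "\<omega> \<alpha> \<beta> \<gamma> = \<omega> (\<Sum>i\<in>UNIV. \<alpha>$i *s axis i 1) (\<Sum>i\<in>UNIV. \<beta>$i *s axis i 1) (\<Sum>i\<in>UNIV. \<gamma>$i *s axis i 1)"
    by (simp only: cart_basis_expansion[symmetric])
  also have "\<dots> = (\<Sum>i\<in>UNIV. \<alpha>$i * \<omega> (axis i 1) (\<Sum>i\<in>UNIV. \<beta>$i *s axis i 1) (\<Sum>i\<in>UNIV. \<gamma>$i *s axis i 1))"
    by (simp only: sums(1) scales(1))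
  also have "\<dots> = (\<Sum>i\<in>UNIV. \<Sum>j\<in>UNIV. \<alpha>$i * \<beta>$j * \<omega> (axis i 1) (axis j 1) (\<Sum>i\<in>UNIV. \<gamma>$i *s axis i 1))"
    by (simp only: sums(2) scales(2) sum_distrib_left mult.assoc)
  also have "\<dots> = (\<Sum>i\<in>UNIV. \<Sum>j\<in>UNIV. \<Sum>k\<in>UNIV.
           \<alpha>$i * \<beta>$j * \<gamma>$k * \<omega> (axis i 1) (axis j 1) (axis k 1))"
    by (simp only: sums(3) scales(3) sum_distrib_left mult.assoc)
  finally show ?thesis .
qed

definition minor :: "'a::comm_ring_1^'n \<Rightarrow> 'a^'n \<Rightarrow> 'a^'n \<Rightarrow> 'n \<Rightarrow> 'n \<Rightarrow> 'n \<Rightarrow> 'a" where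
  "minor \<alpha> \<beta> \<gamma> i j k = \<alpha>$i * \<beta>$j * \<gamma>$k - \<alpha>$i * \<beta>$k * \<gamma>$j + \<alpha>$j * \<beta>$k * \<gamma>$i
     - \<alpha>$j * \<beta>$i * \<gamma>$k + \<alpha>$k * \<beta>$i * \<gamma>$j - \<alpha>$k * \<beta>$j * \<gamma>$i"

lemma alternating_trilinear_add:
  assumes "alternating_trilinear \<omega>"
  shows "\<omega> (x + y) z w = \<omega> x z w + \<omega> y z w" "\<omega> z (x + y) w = \<omega> z x w + \<omega> z y w"
    "\<omega> z w (x + y) = \<omega> z w x + \<omega> z w y"
  using assms by (simp_all add: alternating_trilinear_def Vector_Spaces.linear_iff)

lemma alternating_trilinear_minus:
  assumes "alternating_trilinear \<omega>"
  shows "\<omega> (- x) z w = - \<omega> x z w" "\<omega> z (- x) w = - \<omega> z x w" "\<omega> z w (- x) = - \<omega> z w x"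
  using assms unfolding alternating_trilinear_def Vector_Spaces.linear_iff
  by (metis (no_types) vec.scale_minus_left vec.scale_one mult_minus1)+

lemma alternating_trilinear_swap:
  assumes "alternating_trilinear \<omega>"
  shows "\<omega> x y z = - \<omega> y x z" "\<omega> x y z = - \<omega> x z y"
proof -
  note add = alternating_trilinear_add[OF assms]
  have zero: "\<omega> u u v = 0" "\<omega> u v v = 0" for u v
    using assms by (simp_all add: alternating_trilinear_def)
  have "\<omega> x y z + \<omega> y x z = \<omega> (x + y) (x + y) z" "\<omega> x y z + \<omega> x z y = \<omega> x (y + z) (y + z)"
    unfolding add by (simp_all add: zero)
  then show "\<omega> x y z = - \<omega> y x z" "\<omega> x y z = - \<omega> x z y"
    by (simp_all add: zero add_eq_0_iff2)
qed

text \<open>Among the 216 terms of the trilinear expansion, those with a repeated index vanish, and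
  the six orderings of each remaining triple combine into one minor.\<close>

lemma alternating_expansion:
  fixes \<omega> :: "'a::field^6 \<Rightarrow> 'a^6 \<Rightarrow> 'a^6 \<Rightarrow> 'a"
  assumes "alternating_trilinear \<omega>"
  shows "\<omega> \<alpha> \<beta> \<gamma> = (let c = form_coeff \<omega>; m = minor \<alpha> \<beta> \<gamma> in
          c 1 2 3 * m 1 2 3 + c 1 2 4 * m 1 2 4 + c 1 2 5 * m 1 2 5
           + c 1 2 6 * m 1 2 6 + c 1 3 4 * m 1 3 4 + c 1 3 5 * m 1 3 5
           + c 1 3 6 * m 1 3 6 + c 1 4 5 * m 1 4 5 + c 1 4 6 * m 1 4 6
           + c 1 5 6 * m 1 5 6 + c 2 3 4 * m 2 3 4 + c 2 3 5 * m 2 3 5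
           + c 2 3 6 * m 2 3 6 + c 2 4 5 * m 2 4 5 + c 2 4 6 * m 2 4 6
           + c 2 5 6 * m 2 5 6 + c 3 4 5 * m 3 4 5 + c 3 4 6 * m 3 4 6
           + c 3 5 6 * m 3 5 6 + c 4 5 6 * m 4 5 6)"
proof -
  have zero: "\<omega> u u v = 0" "\<omega> u v v = 0" "\<omega> u v u = 0" for u v
    using assms by (simp_all add: alternating_trilinear_def)
  define c where "c = form_coeff \<omega>"
  have c0: "c i i j = 0" "c i j j = 0" "c i j i = 0" for i j
    unfolding c_def form_coeff_def using zero by auto
  have swap12: "c i j k = - c j i k" and swap23: "c i j k = - c i k j" for i j k
    unfolding c_def form_coeff_def by (rule alternating_trilinear_swap[OF assms])+
  \<comment> \<open>Instantiated at inversions only, the two swaps terminate as rewrite rules that sort indices.\<close>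
  note sort =
    swap12[of 2 1] swap12[of 3 1] swap12[of 4 1] swap12[of 5 1] swap12[of 6 1]
    swap12[of 3 2] swap12[of 4 2] swap12[of 5 2] swap12[of 6 2] swap12[of 4 3]
    swap12[of 5 3] swap12[of 6 3] swap12[of 5 4] swap12[of 6 4] swap12[of 6 5]
    swap23[of _ 2 1] swap23[of _ 3 1] swap23[of _ 4 1] swap23[of _ 5 1] swap23[of _ 6 1]
    swap23[of _ 3 2] swap23[of _ 4 2] swap23[of _ 5 2] swap23[of _ 6 2] swap23[of _ 4 3]
    swap23[of _ 5 3] swap23[of _ 6 3] swap23[of _ 5 4] swap23[of _ 6 4] swap23[of _ 6 5]
  show ?thesis
    unfolding trilinear_expansion[OF assms, folded form_coeff_def] Let_def c_def[symmetric] sum_6 minor_def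
    by (simp only: c0 sort mult_zero_right add_0_left add_0_right) (simp add: algebra_simps)
qed

text \<open>Each minor is alternating in \<open>y, z, w\<close> and vanishes when one of them is a
  multiple of \<open>x\<close>, so it is the determinant times a quadratic factor in
  \<open>x\<close>. The factor is the multiplier of the matching coefficient in
  \<open>Q_form\<close>. The zero cases are the triples spanning the exterior square of a coordinate
  hyperplane; they enter the dual form only.\<close>

lemma minor_wedge:
  fixes x :: "'a::comm_ring_1^4"
  shows
    "minor (wedge x y) (wedge x z) (wedge x w) 1 2 3 = x$1 * x$1 * det (vector [x, y, z, w])"
    "minor (wedge x y) (wedge x z) (wedge x w) 1 2 4 = 0"
    "minor (wedge x y) (wedge x z) (wedge x w) 1 2 5 = x$1 * x$2 * det (vector [x, y, z, w])"
    "minor (wedge x y) (wedge x z) (wedge x w) 1 2 6 = x$1 * x$3 * det (vector [x, y, z, w])"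
    "minor (wedge x y) (wedge x z) (wedge x w) 1 3 4 = - (x$1 * x$2) * det (vector [x, y, z, w])"
    "minor (wedge x y) (wedge x z) (wedge x w) 1 3 5 = 0"
    "minor (wedge x y) (wedge x z) (wedge x w) 1 3 6 = x$1 * x$4 * det (vector [x, y, z, w])"
    "minor (wedge x y) (wedge x z) (wedge x w) 1 4 5 = x$2 * x$2 * det (vector [x, y, z, w])"
    "minor (wedge x y) (wedge x z) (wedge x w) 1 4 6 = x$2 * x$3 * det (vector [x, y, z, w])"
    "minor (wedge x y) (wedge x z) (wedge x w) 1 5 6 = x$2 * x$4 * det (vector [x, y, z, w])"
    "minor (wedge x y) (wedge x z) (wedge x w) 2 3 4 = - (x$1 * x$3) * det (vector [x, y, z, w])"
    "minor (wedge x y) (wedge x z) (wedge x w) 2 3 5 = - (x$1 * x$4) * det (vector [x, y, z, w])"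
    "minor (wedge x y) (wedge x z) (wedge x w) 2 3 6 = 0"
    "minor (wedge x y) (wedge x z) (wedge x w) 2 4 5 = x$2 * x$3 * det (vector [x, y, z, w])"
    "minor (wedge x y) (wedge x z) (wedge x w) 2 4 6 = x$3 * x$3 * det (vector [x, y, z, w])"
    "minor (wedge x y) (wedge x z) (wedge x w) 2 5 6 = x$3 * x$4 * det (vector [x, y, z, w])"
    "minor (wedge x y) (wedge x z) (wedge x w) 3 4 5 = x$2 * x$4 * det (vector [x, y, z, w])"
    "minor (wedge x y) (wedge x z) (wedge x w) 3 4 6 = x$3 * x$4 * det (vector [x, y, z, w])"
    "minor (wedge x y) (wedge x z) (wedge x w) 3 5 6 = x$4 * x$4 * det (vector [x, y, z, w])"
    "minor (wedge x y) (wedge x z) (wedge x w) 4 5 6 = 0"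
  by (simp_all add: minor_def det_4 vector_4 algebra_simps)

text \<open>The intrinsic meaning of \<open>Q_form\<close>: restricted to the Lagrangian of
  \<open>x\<close>, \<omega> is the volume form scaled by \<open>Q_form \<omega> x\<close>.\<close>

lemma alternating_on_wedges:
  fixes \<omega> :: "'a::field^6 \<Rightarrow> 'a^6 \<Rightarrow> 'a^6 \<Rightarrow> 'a"
  assumes "alternating_trilinear \<omega>"
  shows "\<omega> (wedge x y) (wedge x z) (wedge x w) = Q_form \<omega> x * det (vector [x, y, z, w])"
proof -
  show ?thesis
    using alternating_expansion[OF assms, of "wedge x y" "wedge x z" "wedge x w"]
    unfolding Let_def minor_wedge Q_form_def by (simp add: algebra_simps power2_eq_square)
qed

text \<open>The Hodge star exchanges the roles of W and its dual, so facts about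
  \<open>Q_form\<close> carry over to the dual form.\<close>

lemma Q_dual_form_eq:
  fixes \<omega> :: "'a::field^6 \<Rightarrow> 'a^6 \<Rightarrow> 'a^6 \<Rightarrow> 'a"
  assumes "alternating_trilinear \<omega>"
  shows "Q_dual_form \<omega> = Q_form (\<lambda>\<alpha> \<beta> \<gamma>. \<omega> (star \<alpha>) (star \<beta>) (star \<gamma>))"
proof -
  define c where "c = form_coeff \<omega>"
  define d where "d = form_coeff (\<lambda>\<alpha> \<beta> \<gamma>. \<omega> (star \<alpha>) (star \<beta>) (star \<gamma>))"
  have ax: "star (axis 1 1) = axis 6 (1::'a)" "star (axis 2 1) = - axis 5 (1::'a)"
    "star (axis 3 1) = axis 4 (1::'a)" "star (axis 4 1) = axis 3 (1::'a)"
    "star (axis 5 1) = - axis 2 (1::'a)" "star (axis 6 1) = axis 1 (1::'a)"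
    by (simp_all add: vec_eq_iff forall_6 axis_def)
  \<comment> \<open>Up to sign, \<open>star\<close> sends index \<open>k\<close> to
    \<open>7 - k\<close> and so reverses increasing triples; exchanging the outer arguments restores
    the order.\<close>
  have rev: "\<omega> u v w = - \<omega> w v u" for u v w
    using alternating_trilinear_swap[OF assms] by metis
  have "d 1 2 3 = c 4 5 6"
    "d 1 2 4 = c 3 5 6"
    "d 1 2 5 = - c 2 5 6"
    "d 1 2 6 = c 1 5 6"
    "d 1 3 4 = - c 3 4 6"
    "d 1 3 5 = c 2 4 6"
    "d 1 3 6 = - c 1 4 6"
    "d 1 4 5 = c 2 3 6"
    "d 1 4 6 = - c 1 3 6"
    "d 1 5 6 = c 1 2 6"
    "d 2 3 4 = c 3 4 5"
    "d 2 3 5 = - c 2 4 5"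
    "d 2 3 6 = c 1 4 5"
    "d 2 4 5 = - c 2 3 5"
    "d 2 4 6 = c 1 3 5"
    "d 2 5 6 = - c 1 2 5"
    "d 3 4 5 = c 2 3 4"
    "d 3 4 6 = - c 1 3 4"
    "d 3 5 6 = c 1 2 4"
    "d 4 5 6 = c 1 2 3"
    unfolding c_def d_def form_coeff_def ax alternating_trilinear_minus[OF assms]
    by (simp_all, (rule rev | subst rev, simp)+)
  then show ?thesis
    unfolding Q_dual_form_def Q_form_def Let_def c_def[symmetric] d_def[symmetric]
    by (intro ext) simp
qed

lemma alternating_trilinear_star:
  assumes "alternating_trilinear \<omega>"
  shows "alternating_trilinear (\<lambda>\<alpha> \<beta> \<gamma>. \<omega> (star \<alpha>) (star \<beta>) (star \<gamma>))"
  using assms by (simp add: alternating_trilinear_def Vector_Spaces.linear_iff star_add star_scale)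

lemma quadratic_form_Q_dual_form:
  "alternating_trilinear \<omega> \<Longrightarrow> quadratic_form (Q_dual_form \<omega>)"
  by (simp add: Q_dual_form_eq quadratic_form_Q_form)

subsection \<open>Lagrangians\<close>

lemma wedge_add_right: "wedge x (y + z) = wedge x y + wedge x z"
  and wedge_scale_right: "wedge x (c *s y) = c *s wedge x y"
  and wedge_scale_left: "wedge (c *s x) y = c *s wedge x y"
  and wedge_zero_right [simp]: "wedge x 0 = 0"
  and wedge_zero_left [simp]: "wedge 0 x = 0"
  by (simp_all add: vec_eq_iff forall_6 algebra_simps)

lemma linear_wedge: "Vector_Spaces.linear (*s) (*s) (wedge (x :: 'a::field^4))"
  by (simp add: Vector_Spaces.linear_iff wedge_add_right wedge_scale_right vec.vector_space_axioms)

lemma linear_star: "Vector_Spaces.linear (*s) (*s) (star :: 'a::field^6 \<Rightarrow> 'a^6)"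
  by (simp add: Vector_Spaces.linear_iff star_add star_scale vec.vector_space_axioms)

lemma inj_star: "inj_on star A"
  by (metis inj_onI star_star)

lemma mem_star_image: "\<alpha> \<in> star ` L \<longleftrightarrow> star \<alpha> \<in> L"
  by (metis image_iff star_star)

lemma wedge_pairing_star [simp]: "wedge_pairing (star \<alpha>) (star \<beta>) = wedge_pairing \<alpha> \<beta>"
  by (simp add: wedge_pairing_def)

lemma wedge_covector_linear:
  "wedge_covector \<alpha> (x + y) = wedge_covector \<alpha> x + wedge_covector \<alpha> y"
  "wedge_covector \<alpha> (c *s x) = c *s wedge_covector \<alpha> x"
  "wedge_covector \<alpha> 0 = 0" "wedge_covector 0 x = 0"
  by (simp_all add: vec_eq_iff forall_4 algebra_simps)

lemma wedge_covector_wedge [simp]: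
  "wedge_covector (wedge x y) x = 0" "wedge_covector (wedge x y) y = 0"
  by (simp_all add: vec_eq_iff forall_4 algebra_simps)

lemma wedge_covector_star_wedge:
  "wedge_covector (star (wedge x y)) \<phi> = dot \<phi> x *s y - dot \<phi> y *s x"
  by (simp add: vec_eq_iff forall_4 dot_def sum_4 algebra_simps)

lemma dot_axis: "dot (axis i 1) x = x $ i"
  by (simp add: dot_def axis_def if_distrib if_distribR cong: if_cong)

text \<open>For the nontrivial inclusion, the Cartan formula with a coordinate covector not
  vanishing at \<open>x\<close> exhibits \<alpha> as a multiple of \<open>x\<close>.\<close>

lemma range_wedge_eq:
  fixes x :: "'a::field^4"
  assumes "x \<noteq> 0"
  shows "range (wedge x) = {\<alpha>. wedge_covector \<alpha> x = 0}"
proof (intro equalityI subsetI)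
  fix \<alpha> assume "\<alpha> \<in> {\<alpha>. wedge_covector \<alpha> x = 0}"
  then have \<alpha>: "wedge_covector \<alpha> x = 0" by simp
  obtain i where i: "x $ i \<noteq> 0" using assms by (auto simp: vec_eq_iff)
  have "x $ i *s \<alpha> = wedge x (wedge_covector (star \<alpha>) (axis i 1))"
    using cartan_formula[of "axis i 1" x \<alpha>] \<alpha> by (simp add: dot_axis)
  then have "(1 / x $ i) *s (x $ i *s \<alpha>) = wedge x ((1 / x $ i) *s wedge_covector (star \<alpha>) (axis i 1))"
    by (simp only: wedge_scale_right)
  then have "\<alpha> = wedge x ((1 / x $ i) *s wedge_covector (star \<alpha>) (axis i 1))"
    using i by simp
  then show "\<alpha> \<in> range (wedge x)" by blast
qed auto

lemma wedge_eq_0_imp: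
  fixes x :: "'a::field^4"
  assumes "x \<noteq> 0" "wedge x y = 0"
  shows "\<exists>c. y = c *s x"
proof -
  obtain i where i: "x $ i \<noteq> 0" using assms by (auto simp: vec_eq_iff)
  have "x $ i * y $ j = y $ i * x $ j" for j
    using wedge_covector_star_wedge[of x y "axis i 1"] assms(2)
    by (simp add: dot_axis wedge_covector_linear vec_eq_iff)
  then have "y = (y $ i / x $ i) *s x"
    using i by (simp add: vec_eq_iff field_simps)
  then show ?thesis ..
qed

lemma subspace_range_wedge: "vec.subspace (range (wedge x))"
  using vec.linear_subspace_image[OF linear_wedge vec.subspace_UNIV] .

text \<open>The kernel of \<open>wedge x\<close> is the line of \<open>x\<close>. If
  \<open>x $ i\<close> is nonzero, the hyperplane where coordinate \<open>i\<close> vanishes is a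
  complement of that line, so it maps isomorphically onto the range.\<close>

lemma dim_range_wedge:
  fixes x :: "'a::field^4"
  assumes "x \<noteq> 0"
  shows "vec.dim (range (wedge x)) = 3"
proof -
  obtain i where i: "x $ i \<noteq> 0" using assms by (auto simp: vec_eq_iff)
  let ?S = "{y::'a^4. y $ i = 0}"
  have "card (- {i}) = 3" by (simp add: Compl_eq_Diff_UNIV card_Diff_subset)
  then have dim: "vec.dim ?S = 3" using dim_substandard_cart[of "- {i}", where 'a = 'a] by simp
  have sub: "vec.subspace ?S" by (simp add: vec.subspace_def)
  have "inj_on (wedge x) ?S"
    unfolding vec.linear_inj_on_iff_eq_0[OF linear_wedge sub]
  proof (intro ballI impI)
    fix y assume y: "y \<in> ?S" "wedge x y = 0"
    then obtain c where "y = c *s x" using wedge_eq_0_imp[OF assms] by blast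
    with y(1) i show "y = 0" by simp
  qed
  then have "vec.dim (wedge x ` ?S) = 3"
    using vec.dim_image_eq[OF linear_wedge, of x ?S] sub dim
    by (simp add: vec.span_eq_iff[THEN iffD2])
  moreover have "range (wedge x) = wedge x ` ?S"
  proof (intro equalityI subsetI)
    fix \<alpha> assume "\<alpha> \<in> range (wedge x)"
    then obtain y where "\<alpha> = wedge x y" by auto
    moreover have "wedge x y = wedge x (y + (- y $ i / x $ i) *s x)"
      by (simp add: vec_eq_iff forall_6 algebra_simps)
    moreover have "y + (- y $ i / x $ i) *s x \<in> ?S" using i by simp
    ultimately show "\<alpha> \<in> wedge x ` ?S" by blast
  qed auto
  ultimately show ?thesis by simp
qed

lemma lagrangian_range_wedge:
  fixes x :: "'a::field^4"
  assumes "x \<noteq> 0"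
  shows "lagrangian (range (wedge x))"
proof -
  have "wedge_pairing (wedge x y) (wedge x z) = 0" for y z
    by (simp add: covector_wedge dot_def)
  then show ?thesis
    by (auto simp: lagrangian_def subspace_range_wedge dim_range_wedge[OF assms])
qed

lemma lagrangian_star:
  assumes "lagrangian L"
  shows "lagrangian (star ` L)"
  using assms vec.linear_subspace_image[OF linear_star, of L]
    vec.dim_image_eq[OF linear_star inj_star, of L]
  by (auto simp: lagrangian_def)

lemma null_for_star: "null_for \<omega> (star ` L) \<longleftrightarrow> null_for (\<lambda>\<alpha> \<beta> \<gamma>. \<omega> (star \<alpha>) (star \<beta>) (star \<gamma>)) L"
  by (auto simp: null_for_def)

text \<open>Completing \<open>x\<close> by the standard basis vectors other than the one with index
  \<open>i\<close> gives determinant \<open>x $ i\<close> up to sign.\<close>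

lemma exists_det_vector_nonzero:
  fixes x :: "'a::field^4"
  assumes "x \<noteq> 0"
  shows "\<exists>y z w. det (vector [x, y, z, w] :: 'a^4^4) \<noteq> 0"
proof (rule ccontr)
  assume "\<not> ?thesis"
  then have det: "det (vector [x, y, z, w] :: 'a^4^4) = 0" for y z w by blast
  have "x $ 1 = 0" "x $ 2 = 0" "x $ 3 = 0" "x $ 4 = 0"
    using det[of "axis 2 1" "axis 3 1" "axis 4 1"] det[of "axis 1 1" "axis 3 1" "axis 4 1"]
      det[of "axis 1 1" "axis 2 1" "axis 4 1"] det[of "axis 1 1" "axis 2 1" "axis 3 1"]
    by (simp_all add: det_4 vector_4 axis_def)
  then show False using assms by (simp add: vec_eq_iff forall_4)
qed

lemma null_for_range_wedge:
  assumes "alternating_trilinear \<omega>" "x \<noteq> 0"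
  shows "null_for \<omega> (range (wedge x)) \<longleftrightarrow> Q_form \<omega> x = 0"
  using exists_det_vector_nonzero[OF assms(2)]
  by (auto simp: null_for_def alternating_on_wedges[OF assms(1)])

lemma null_for_star_range_wedge:
  assumes "alternating_trilinear \<omega>" "\<phi> \<noteq> 0"
  shows "null_for \<omega> (star ` range (wedge \<phi>)) \<longleftrightarrow> Q_dual_form \<omega> \<phi> = 0"
  unfolding null_for_star Q_dual_form_eq[OF assms(1)]
  by (rule null_for_range_wedge[OF alternating_trilinear_star[OF assms(1)] assms(2)])

text \<open>Some contraction of \<alpha> is a nonzero vector. The Clifford relation and isotropy
  make twice its product with \<alpha> vanish, so it divides \<alpha>.\<close>

lemma isotropic_decomposable:
  fixes \<alpha> :: "'a::field^6"
  assumes two: "(2::'a) \<noteq> 0" and "\<alpha> \<noteq> 0" "wedge_pairing \<alpha> \<alpha> = 0"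
  shows "\<exists>x y. \<alpha> = wedge x y"
proof -
  have "\<exists>\<phi>. wedge_covector (star \<alpha>) \<phi> \<noteq> 0"
  proof (rule ccontr)
    assume "\<not> ?thesis"
    \<comment> \<open>Up to sign, these entries for \<open>i < j\<close> are the six coordinates of
      \<alpha>.\<close>
    then have "wedge_covector (star \<alpha>) (axis i 1) $ j = 0" for i j by simp
    from this[of 1 2] this[of 1 3] this[of 1 4] this[of 2 3] this[of 2 4] this[of 3 4]
    have "\<alpha> = 0" by (simp add: vec_eq_iff forall_6 axis_def)
    with \<open>\<alpha> \<noteq> 0\<close> show False ..
  qed
  then obtain \<phi> where \<phi>: "wedge_covector (star \<alpha>) \<phi> \<noteq> 0" ..
  let ?x = "wedge_covector (star \<alpha>) \<phi>"
  have "wedge_covector \<alpha> ?x + wedge_covector \<alpha> ?x = 0"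
    using clifford_relation[of "star \<alpha>" "star \<alpha>" \<phi>] assms(3) by simp
  then have "2 *s wedge_covector \<alpha> ?x = 0"
    by (simp add: vec_eq_iff)
  then have "\<alpha> \<in> range (wedge ?x)"
    using two range_wedge_eq[OF \<phi>] by simp
  then show ?thesis by blast
qed

lemma det_vector_zero_imp_dependent:
  fixes a b c d :: "'a::field^4"
  assumes "det (vector [a, b, c, d] :: 'a^4^4) = 0"
  shows "\<exists>r s t u. (r, s, t, u) \<noteq> (0, 0, 0, 0) \<and> r *s a + s *s b + t *s c + u *s d = 0"
proof -
  let ?A = "vector [a, b, c, d] :: 'a^4^4"
  have "\<not> invertible ?A" using assms invertible_det_nz by blast
  then obtain k where "(\<Sum>i\<in>UNIV. k i *s row i ?A) = 0" "\<exists>i. k i \<noteq> 0"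
    unfolding invertible_right_inverse matrix_right_invertible_independent_rows by blast
  then have "k 1 *s a + k 2 *s b + k 3 *s c + k 4 *s d = 0" "(k 1, k 2, k 3, k 4) \<noteq> (0, 0, 0, 0)"
    using forall_4[of "\<lambda>i. k i = 0"] by (auto simp: sum_4 row_def vector_4)
  then show ?thesis by blast
qed

lemma wedge_nonzero_imp_independent:
  fixes a b :: "'a::field^4"
  assumes "wedge a b \<noteq> 0" "r *s a + s *s b = 0"
  shows "r = 0 \<and> s = 0"
proof -
  have "wedge a (r *s a + s *s b) = s *s wedge a b" "wedge (r *s a + s *s b) b = r *s wedge a b"
    by (simp_all add: vec_eq_iff forall_6 algebra_simps)
  then show ?thesis using assms(1) unfolding assms(2) by simp
qed

text \<open>Both vectors are decomposable, and their pairing is the determinant of the four factors.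
  Its vanishing makes the two planes of factors meet in a nonzero \<open>x\<close>.\<close>

lemma isotropic_pair_common_factor:
  fixes \<alpha> \<beta> :: "'a::field^6"
  assumes "(2::'a) \<noteq> 0" "\<alpha> \<noteq> 0" "\<beta> \<noteq> 0"
    and "wedge_pairing \<alpha> \<alpha> = 0" "wedge_pairing \<beta> \<beta> = 0" "wedge_pairing \<alpha> \<beta> = 0"
  shows "\<exists>x. x \<noteq> 0 \<and> wedge_covector \<alpha> x = 0 \<and> wedge_covector \<beta> x = 0"
proof -
  obtain a b c d where ab: "\<alpha> = wedge a b" and cd: "\<beta> = wedge c d"
    using isotropic_decomposable assms by metis
  have "det (vector [a, b, c, d] :: 'a^4^4) = 0"
    using assms(6) by (simp add: ab cd wedge_pairing_wedge)
  then obtain r s t u where rel: "(r, s, t, u) \<noteq> (0, 0, 0, 0)" "r *s a + s *s b + t *s c + u *s d = 0"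
    using det_vector_zero_imp_dependent by blast
  define x where "x = r *s a + s *s b"
  have "x = - (t *s c + u *s d)"
    using rel(2) by (simp only: x_def eq_neg_iff_add_eq_0 add.assoc)
  then have x': "x = (- t) *s c + (- u) *s d"
    by (simp add: vec_eq_iff)
  \<comment> \<open>If \<open>x\<close> were zero, both halves of the relation would be trivial,
    since \<open>a, b\<close> and \<open>c, d\<close> are independent pairs.\<close>
  have "x \<noteq> 0"
    using wedge_nonzero_imp_independent[of a b r s] wedge_nonzero_imp_independent[of c d "- t" "- u"]
      assms(2,3) rel(1) x' by (auto simp: x_def ab cd)
  moreover have "wedge_covector \<alpha> x = 0" by (simp add: x_def ab wedge_covector_linear)
  moreover have "wedge_covector \<beta> x = 0" unfolding x'
    by (simp only: cd wedge_covector_linear wedge_covector_wedge) simp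
  ultimately show ?thesis by blast
qed

text \<open>Two basis vectors share a factor \<open>x\<close>. If \<open>x\<close> divides the third
  one too, all lie in the Lagrangian of \<open>x\<close>. Otherwise the product of the third with
  \<open>x\<close> is a nonzero covector \<theta>, and the Clifford relations put all three into the
  exterior square of its kernel. Equality of dimensions finishes both cases.\<close>

lemma lagrangian_classification:
  fixes L :: "('a::field^6) set"
  assumes two: "(2::'a) \<noteq> 0" and L: "lagrangian L"
  shows "(\<exists>x. x \<noteq> 0 \<and> L = range (wedge x)) \<or> (\<exists>\<phi>. \<phi> \<noteq> 0 \<and> L = star ` range (wedge \<phi>))"
proof -
  have sub: "vec.subspace L" and dim: "vec.dim L = 3"
    and iso: "\<And>\<alpha> \<beta>. \<alpha> \<in> L \<Longrightarrow> \<beta> \<in> L \<Longrightarrow> wedge_pairing \<alpha> \<beta> = 0"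
    using L by (auto simp: lagrangian_def)
  obtain B where B: "B \<subseteq> L" "vec.independent B" "L \<subseteq> vec.span B" "card B = 3"
    using vec.basis_exists[of L] dim by metis
  have eqI: "L = M" if M: "lagrangian M" "B \<subseteq> M" for M
  proof (rule vec.subspace_dim_equal)
    show "L \<subseteq> M" using B(3) M vec.span_minimal[of B M] by (auto simp: lagrangian_def)
  qed (use sub dim M in \<open>auto simp: lagrangian_def\<close>)
  obtain \<alpha> \<beta> \<gamma> where B_eq: "B = {\<alpha>, \<beta>, \<gamma>}" using B(4)
    by (auto simp: card_3_iff)
  then have "\<alpha> \<noteq> 0" "\<beta> \<noteq> 0" using B(2) vec.dependent_zero[of B] by auto
  then obtain x where x: "x \<noteq> 0" "wedge_covector \<alpha> x = 0" "wedge_covector \<beta> x = 0"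
    using isotropic_pair_common_factor[OF two, of \<alpha> \<beta>] iso B(1) B_eq by blast
  define \<theta> where "\<theta> = wedge_covector \<gamma> x"
  show ?thesis
  proof (cases "\<theta> = 0")
    case True
    then have "B \<subseteq> range (wedge x)"
      using x by (auto simp: range_wedge_eq B_eq \<theta>_def)
    then show ?thesis using eqI[OF lagrangian_range_wedge[OF x(1)]] x(1) by blast
  next
    case False
    have "wedge_covector (star \<delta>) \<theta> = 0" if "\<delta> = \<alpha> \<or> \<delta> = \<beta>" for \<delta>
      using clifford_relation[of \<delta> \<gamma> x] iso[of \<delta> \<gamma>] that x B(1) B_eq
      by (auto simp: \<theta>_def wedge_covector_linear)
    moreover have "2 *s wedge_covector (star \<gamma>) \<theta> = 0"
      using clifford_relation[of \<gamma> \<gamma> x] iso[of \<gamma> \<gamma>] B(1) B_eq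
      by (simp add: \<theta>_def vec_eq_iff)
    then have "wedge_covector (star \<gamma>) \<theta> = 0" using two by simp
    ultimately have "B \<subseteq> star ` range (wedge \<theta>)"
      by (auto simp: B_eq mem_star_image range_wedge_eq[OF False])
    then show ?thesis
      using eqI[OF lagrangian_star[OF lagrangian_range_wedge[OF False]]] False by blast
  qed
qed

section \<open>Intersections of Lagrangians of the same and of different kinds\<close>

lemma range_wedge_Int_nontrivial:
  fixes x y :: "'a::field^4"
  assumes "x \<noteq> 0" "y \<noteq> 0"
  shows "range (wedge x) \<inter> range (wedge y) \<noteq> {0}"
proof
  assume Int: "range (wedge x) \<inter> range (wedge y) = {0}"
  \<comment> \<open>This product lies in both ranges. If it vanishes, \<open>x\<close> and
    \<open>y\<close> are proportional and the second range lies inside the first.\<close>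
  have "wedge x y = wedge y (- x)" by (simp add: vec_eq_iff forall_6 algebra_simps)
  then have "wedge x y = 0" using Int by blast
  then obtain c where "y = c *s x" using wedge_eq_0_imp[OF assms(1)] by blast
  then have "range (wedge y) \<subseteq> range (wedge x)"
    by (auto simp: wedge_scale_left simp flip: wedge_scale_right)
  then have "range (wedge y) = {0}" using Int by blast
  then show False using dim_range_wedge[OF assms(2)] by simp
qed

text \<open>If \<phi>(x) is nonzero, the Cartan formula kills any common element. If it is zero, the
  two summands of that formula are opposite and hence lie in both spaces; a trivial intersection
  would then collapse the Lagrangian of \<open>x\<close> to dimension at most 1.\<close>

lemma range_wedge_Int_star:
  fixes x \<phi> :: "'a::field^4"
  assumes x: "x \<noteq> 0" and \<phi>: "\<phi> \<noteq> 0"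
  shows "range (wedge x) \<inter> star ` range (wedge \<phi>) = {0} \<longleftrightarrow> dot \<phi> x \<noteq> 0"
proof
  assume Int: "range (wedge x) \<inter> star ` range (wedge \<phi>) = {0}"
  show "dot \<phi> x \<noteq> 0"
  proof
    assume zero: "dot \<phi> x = 0"
    have vanish: "wedge x (wedge_covector (star \<alpha>) \<phi>) = 0" for \<alpha>
    proof -
      have "wedge x (wedge_covector (star \<alpha>) \<phi>) = star (wedge \<phi> (- wedge_covector \<alpha> x))"
        using cartan_formula[of \<phi> x \<alpha>] zero
        by (simp add: eq_neg_iff_add_eq_0 vec_eq_iff forall_6 algebra_simps)
      then show ?thesis using Int by blast
    qed
    obtain i where i: "\<phi> $ i \<noteq> 0" using \<phi> by (auto simp: vec_eq_iff)
    \<comment> \<open>Normalised so that \<phi> takes the value 1 at it; contracting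
      \<open>wedge ?u v\<close> then yields \<open>v\<close> minus a multiple of
      \<open>?u\<close>.\<close>
    let ?u = "axis i (1 / \<phi> $ i)"
    have "dot \<phi> ?u = 1" using i by (simp add: dot_def axis_def if_distrib cong: if_cong)
    then have "wedge x v = dot \<phi> v *s wedge x ?u" for v
      using vanish[of "wedge ?u v"]
      by (simp add: wedge_covector_star_wedge vec_eq_iff forall_6 algebra_simps)
    then have "range (wedge x) \<subseteq> vec.span {wedge x ?u}"
      by (metis image_subsetI vec.span_scale vec.span_base insertI1)
    then have "vec.dim (range (wedge x)) \<le> card {wedge x ?u}" by (rule vec.dim_le_card) simp
    then show False using dim_range_wedge[OF x] by simp
  qed
next
  assume nz: "dot \<phi> x \<noteq> 0"
  have "\<alpha> = 0" if "\<alpha> \<in> range (wedge x)" "\<alpha> \<in> star ` range (wedge \<phi>)" for \<alpha>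
    using cartan_formula[of \<phi> x \<alpha>] that nz
    by (simp add: mem_star_image range_wedge_eq x \<phi>)
  moreover have "0 \<in> range (wedge x)" "0 \<in> star ` range (wedge \<phi>)"
    using x \<phi> by (simp_all add: mem_star_image range_wedge_eq wedge_covector_linear)
  ultimately show "range (wedge x) \<inter> star ` range (wedge \<phi>) = {0}" by blast
qed

lemma range_wedge_plus_star:
  fixes x \<phi> :: "'a::field^4"
  assumes nz: "dot \<phi> x \<noteq> 0"
  shows "{\<alpha> + \<beta> | \<alpha> \<beta>. \<alpha> \<in> range (wedge x) \<and> \<beta> \<in> star ` range (wedge \<phi>)} = UNIV"
proof -
  have "\<gamma> \<in> {\<alpha> + \<beta> | \<alpha> \<beta>. \<alpha> \<in> range (wedge x) \<and> \<beta> \<in> star ` range (wedge \<phi>)}" for \<gamma>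
  proof -
    let ?k = "1 / dot \<phi> x"
    have "\<gamma> = ?k *s (dot \<phi> x *s \<gamma>)" using nz by simp
    also have "\<dots> = wedge x (?k *s wedge_covector (star \<gamma>) \<phi>) + star (wedge \<phi> (?k *s wedge_covector \<gamma> x))"
      by (simp only: cartan_formula vec.scale_right_distrib wedge_scale_right star_scale)
    finally show ?thesis by blast
  qed
  then show ?thesis by blast
qed

text \<open>The condition \<open>dot \<phi> x \<noteq> 0\<close> makes both vectors nonzero, so the
  right-hand side needs no separate clause for that.\<close>

lemma dual_null_lagrangian_pair_iff:
  fixes \<omega> :: "'a::field^6 \<Rightarrow> 'a^6 \<Rightarrow> 'a^6 \<Rightarrow> 'a"
  assumes two: "(2::'a) \<noteq> 0" and \<omega>: "alternating_trilinear \<omega>"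
  shows "(\<exists>L\<^sub>1 L\<^sub>2. dual_null_lagrangian_pair \<omega> L\<^sub>1 L\<^sub>2) \<longleftrightarrow>
    (\<exists>x \<phi>. Q_form \<omega> x = 0 \<and> Q_dual_form \<omega> \<phi> = 0 \<and> dot \<phi> x \<noteq> 0)"
proof
  assume "\<exists>x \<phi>. Q_form \<omega> x = 0 \<and> Q_dual_form \<omega> \<phi> = 0 \<and> dot \<phi> x \<noteq> 0"
  then obtain x \<phi> where Q: "Q_form \<omega> x = 0" "Q_dual_form \<omega> \<phi> = 0" and nz: "dot \<phi> x \<noteq> 0" by blast
  then have x: "x \<noteq> 0" and \<phi>: "\<phi> \<noteq> 0" by (auto simp: dot_def)
  have "dual_null_lagrangian_pair \<omega> (range (wedge x)) (star ` range (wedge \<phi>))"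
    unfolding dual_null_lagrangian_pair_def
    using lagrangian_range_wedge[OF x] lagrangian_star[OF lagrangian_range_wedge[OF \<phi>]]
      null_for_range_wedge[OF \<omega> x] null_for_star_range_wedge[OF \<omega> \<phi>] Q
      range_wedge_Int_star[OF x \<phi>] range_wedge_plus_star[OF nz] nz by simp
  then show "\<exists>L\<^sub>1 L\<^sub>2. dual_null_lagrangian_pair \<omega> L\<^sub>1 L\<^sub>2" by blast
next
  assume "\<exists>L\<^sub>1 L\<^sub>2. dual_null_lagrangian_pair \<omega> L\<^sub>1 L\<^sub>2"
  then obtain L M where L: "lagrangian L" "null_for \<omega> L" and M: "lagrangian M" "null_for \<omega> M"
    and Int: "L \<inter> M = {0}"
    by (auto simp: dual_null_lagrangian_pair_def)
  have mixed: "\<exists>x \<phi>. Q_form \<omega> x = 0 \<and> Q_dual_form \<omega> \<phi> = 0 \<and> dot \<phi> x \<noteq> 0"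
    if "x \<noteq> 0" "\<phi> \<noteq> 0" "null_for \<omega> (range (wedge x))" "null_for \<omega> (star ` range (wedge \<phi>))"
      "range (wedge x) \<inter> star ` range (wedge \<phi>) = {0}" for x \<phi>
    using null_for_range_wedge[OF \<omega> that(1)] null_for_star_range_wedge[OF \<omega> that(2)]
      range_wedge_Int_star[OF that(1,2)] that(3-5) by (intro exI[of _ x] exI[of _ \<phi>]) simp
  have star_Int: "star ` range (wedge x) \<inter> star ` range (wedge y) \<noteq> {0}" if "x \<noteq> 0" "y \<noteq> 0" for x y :: "'a^4"
  proof
    assume "star ` range (wedge x) \<inter> star ` range (wedge y) = {0}"
    then have "star ` (range (wedge x) \<inter> range (wedge y)) = star ` {0}"
      by (simp add: image_Int[OF inj_star])
    then have "range (wedge x) \<inter> range (wedge y) = {0}"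
      by (simp only: inj_image_eq_iff[OF inj_star])
    with range_wedge_Int_nontrivial[OF that] show False by blast
  qed
  from lagrangian_classification[OF two L(1)] lagrangian_classification[OF two M(1)]
  show "\<exists>x \<phi>. Q_form \<omega> x = 0 \<and> Q_dual_form \<omega> \<phi> = 0 \<and> dot \<phi> x \<noteq> 0"
  proof (elim disjE exE conjE)
    fix x y assume "x \<noteq> 0" "L = range (wedge x)" "y \<noteq> 0" "M = range (wedge y)"
    then show ?thesis using Int range_wedge_Int_nontrivial by blast
  next
    fix x \<phi> assume "x \<noteq> 0" "L = range (wedge x)" "\<phi> \<noteq> 0" "M = star ` range (wedge \<phi>)"
    then show ?thesis using mixed[of x \<phi>] L(2) M(2) Int by simp
  next
    fix \<phi> x assume "\<phi> \<noteq> 0" "L = star ` range (wedge \<phi>)" "x \<noteq> 0" "M = range (wedge x)"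
    then show ?thesis using mixed[of x \<phi>] L(2) M(2) Int by (simp add: Int_commute)
  next
    fix \<phi> \<psi> assume "\<phi> \<noteq> 0" "L = star ` range (wedge \<phi>)" "\<psi> \<noteq> 0" "M = star ` range (wedge \<psi>)"
    then show ?thesis using Int star_Int by blast
  qed
qed

lemma no_dual_null_lagrangian_pair_iff:
  fixes \<omega> :: "'a::{field,finite}^6 \<Rightarrow> 'a^6 \<Rightarrow> 'a^6 \<Rightarrow> 'a"
  assumes odd: "odd CARD('a)" and two: "(2::'a) \<noteq> 0" and \<omega>: "alternating_trilinear \<omega>"
  shows "(\<nexists>L\<^sub>1 L\<^sub>2. dual_null_lagrangian_pair \<omega> L\<^sub>1 L\<^sub>2) \<longleftrightarrow>
    (\<exists>R. vec.subspace R \<and> vec.dim R = 2 \<and> {x. Q_form \<omega> x = 0} = R \<and>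
         {\<phi>. Q_dual_form \<omega> \<phi> = 0} = annihilator R)" (is "?no_pair \<longleftrightarrow> ?plane")
proof -
  let ?Z = "{x. Q_form \<omega> x = 0}" and ?Z' = "{\<phi>. Q_dual_form \<omega> \<phi> = 0}"
  have "?no_pair \<longleftrightarrow> (\<forall>x\<in>?Z. \<forall>\<phi>\<in>?Z'. dot \<phi> x = 0)"
    unfolding dual_null_lagrangian_pair_iff[OF two \<omega>] by blast
  also have "\<dots> \<longleftrightarrow> ?plane"
  proof
    assume orth: "\<forall>x\<in>?Z. \<forall>\<phi>\<in>?Z'. dot \<phi> x = 0"
    let ?R = "vec.span ?Z"
    have "vec.span ?Z \<subseteq> {x. dot \<phi> x = 0}" if "\<phi> \<in> ?Z'" for \<phi>
      using orth that by (intro vec.span_minimal subspace_dot_zero) blast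
    then have Z'_sub: "?Z' \<subseteq> annihilator ?R"
      unfolding annihilator_eq by blast
    have "2 \<le> vec.dim ?R" "2 \<le> vec.dim ?Z'"
      using two_le_dim_zeros[OF quadratic_form_Q_form odd two]
        two_le_dim_zeros[OF quadratic_form_Q_dual_form[OF \<omega>] odd two] by simp_all
    moreover have "vec.dim ?Z' \<le> vec.dim (annihilator ?R)"
      using Z'_sub by (rule vec.dim_subset)
    moreover have "vec.dim ?R + vec.dim (annihilator ?R) \<le> 4"
      using dim_annihilator_le[of ?R] by simp
    \<comment> \<open>Two lower bounds of 2 and a sum of at most 4 leave only equality, so
      \<open>zeros_in_plane\<close> applies to both forms.\<close>
    ultimately have dims: "vec.dim ?R = 2" "vec.dim (annihilator ?R) \<le> 2"
      by linarith+
    have "Q_form \<omega> x = 0" if "x \<in> ?R" for x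
      by (rule zeros_in_plane[OF quadratic_form_Q_form odd two _ _ vec.span_superset that])
        (simp_all only: vec.subspace_span dims)
    then have "?Z = ?R"
      using vec.span_superset[of ?Z] by blast
    moreover have "Q_dual_form \<omega> \<phi> = 0" if "\<phi> \<in> annihilator ?R" for \<phi>
      by (rule zeros_in_plane[OF quadratic_form_Q_dual_form[OF \<omega>] odd two
            subspace_annihilator dims(2) Z'_sub that])
    then have "?Z' = annihilator ?R"
      using Z'_sub by blast
    ultimately show ?plane
      using dims(1) vec.subspace_span[of ?Z] by blast
  next
    assume ?plane
    then show "\<forall>x\<in>?Z. \<forall>\<phi>\<in>?Z'. dot \<phi> x = 0"
      by (auto simp: annihilator_eq)
  qed
  finally show ?thesis .
qed

theorem theorem5:
  fixes \<omega> :: "'p::prime_card mod_ring^6 \<Rightarrow> 'p mod_ring^6 \<Rightarrow> 'p mod_ring^6 \<Rightarrow> 'p mod_ring"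
  assumes "odd CARD('p)"
    and "alternating_trilinear \<omega>"
  shows "((\<nexists>L\<^sub>1 L\<^sub>2. dual_null_lagrangian_pair \<omega> L\<^sub>1 L\<^sub>2) \<longleftrightarrow>
           (\<exists>R. vec.subspace R \<and> vec.dim R = 2 \<and>
                radical (Q_form \<omega>) = R \<and>
                anisotropic_quotient (Q_form \<omega>) R \<and>
                radical (Q_dual_form \<omega>) = annihilator R \<and>
                anisotropic_quotient (Q_dual_form \<omega>) (annihilator R)))
       \<and> ((\<exists>R. vec.subspace R \<and> vec.dim R = 2 \<and>
                radical (Q_form \<omega>) = R \<and>
                anisotropic_quotient (Q_form \<omega>) R \<and>
                radical (Q_dual_form \<omega>) = annihilator R \<and>
                anisotropic_quotient (Q_dual_form \<omega>) (annihilator R)) \<longleftrightarrow>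
           (\<exists>R. vec.subspace R \<and> vec.dim R = 2 \<and>
                zero_locus (Q_form \<omega>) = proj R \<and>
                zero_locus (Q_dual_form \<omega>) = proj (annihilator R)))"
proof -
  \<comment> \<open>If 2 vanished, the odd prime \<open>CARD('p)\<close> would divide 2.\<close>
  have two: "(2 :: 'p mod_ring) \<noteq> 0"
  proof
    assume "(2 :: 'p mod_ring) = 0"
    then have "CARD('p) dvd 2"
      using of_nat_0_mod_ring_dvd[of 2, where 'a = 'p] by simp
    then show False
      using assms(1) prime_card[where 'a = 'p] by (metis dvd_refl primes_dvd_imp_eq two_is_prime_nat)
  qed
  note q = quadratic_form_Q_form[of \<omega>] quadratic_form_Q_dual_form[OF assms(2)]
  have no_pair: "(\<nexists>L\<^sub>1 L\<^sub>2. dual_null_lagrangian_pair \<omega> L\<^sub>1 L\<^sub>2) \<longleftrightarrow>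
    (\<exists>R. vec.subspace R \<and> vec.dim R = 2 \<and> {x. Q_form \<omega> x = 0} = R \<and>
         {\<phi>. Q_dual_form \<omega> \<phi> = 0} = annihilator R)"
    using assms(1) by (intro no_dual_null_lagrangian_pair_iff two assms(2)) simp
  \<comment> \<open>For each fixed \<open>R\<close>, this description and the projective one below
    reduce to the same equalities of zero sets, so one plane witnesses all conditions.\<close>
  have radical: "radical (Q_form \<omega>) = R \<and> anisotropic_quotient (Q_form \<omega>) R \<and>
      radical (Q_dual_form \<omega>) = annihilator R \<and>
      anisotropic_quotient (Q_dual_form \<omega>) (annihilator R) \<longleftrightarrow>
      {x. Q_form \<omega> x = 0} = R \<and> {\<phi>. Q_dual_form \<omega> \<phi> = 0} = annihilator R"
    if "vec.subspace R" for R
    using zeros_eq_iff_radical[OF q(1) two that]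
      zeros_eq_iff_radical[OF q(2) two subspace_annihilator[of R]] by argo
  have locus: "zero_locus (Q_form \<omega>) = proj R \<and> zero_locus (Q_dual_form \<omega>) = proj (annihilator R) \<longleftrightarrow>
      {x. Q_form \<omega> x = 0} = R \<and> {\<phi>. Q_dual_form \<omega> \<phi> = 0} = annihilator R"
    if "vec.subspace R" for R
    using zero_locus_eq_proj_iff[OF q(1) that]
      zero_locus_eq_proj_iff[OF q(2) subspace_annihilator[of R]] by argo
  show ?thesis
    unfolding no_pair
    by (intro conjI ex_cong1; rule conj_cong[OF refl]; simp only: radical locus)
qed

end
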